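(* There exists a non-recursive real $x\in 2^\omega$ which is not random with respect to any continuous measure, i.e. for every continuous Borel probability measure $\mu$ on $2^\omega$ and every representation $p$ of $\mu$, $x$ is not $\mu$-random with respect to $p$.
   Context: A Borel probability measure $\mu$ on $2^\omega$ is continuous if $\mu(\{y\})=0$ for every $y\in2^\omega$; it is identified with $\sigma\mapsto\mu([\sigma])$ where $[\sigma]=\{y:\sigma\sqsubset y\}$. Measures are represented by reals: one fixes an effective enumeration of the countable dense set of measures $\sum_{\sigma\in\Delta}Q(\sigma)\delta_{\sigma0^\omega}$ ($\Delta$ finite set of strings, $Q$ rational, summing to $1$) in the space of measures with the weak topology and metric $d(\mu,\nu)=\sum_{n\ge1}2^{-n}\frac12\sum_{|\sigma|=n}|\mu([\sigma])-\nu([\sigma])|$; a representation $p$ of $\mu$ is an element of a fixed $\Pi^0_1$ class $P\subseteq$ (paths of a recursive, recursively bounded branching tree) coding a Cauchy sequence of such measures converging to $\mu$. A $p$-Martin-Löf test is a sequence $(U_n)$ of sets of strings uniformly r.e. in $p$ with $\sum_{\sigma\in U_n}\mu([\sigma])\le2^{-n}$; $x$ is $\mu$-random with respect to $p$ if it lies in $\bigcap_n\bigcup_{\sigma\in U_n}[\sigma]$ for no such test. *)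

theory Defs
  imports "HOL-Probability.Probability" "HOL-Library.Nat_Bijection"
begin

text \<open>
  Kleene's partial recursive functions relative to an oracle \<open>f :: nat \<Rightarrow> nat\<close>:
  \<open>eval f e xs y\<close> means that the program \<open>e\<close> with oracle \<open>f\<close> halts on the arguments \<open>xs\<close>
  with output \<open>y\<close>.
\<close>

datatype prog =
    Zero
  | Succ
  | Oracle
  | Proj nat
  | Comp prog "prog list"
  | PrimRec prog prog
  | Mu prog

inductive eval :: "(nat \<Rightarrow> nat) \<Rightarrow> prog \<Rightarrow> nat list \<Rightarrow> nat \<Rightarrow> bool" for f :: "nat \<Rightarrow> nat" where
  eval_Zero: "eval f Zero xs 0"
| eval_Succ: "eval f Succ (x # xs) (Suc x)"
| eval_Oracle: "eval f Oracle (x # xs) (f x)"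
| eval_Proj: "i < length xs \<Longrightarrow> eval f (Proj i) xs (xs ! i)"
| eval_Comp: "length ys = length gs \<Longrightarrow> \<forall>i < length gs. eval f (gs ! i) xs (ys ! i) \<Longrightarrow>
    eval f h ys z \<Longrightarrow> eval f (Comp h gs) xs z"
| eval_PrimRec_0: "eval f g xs y \<Longrightarrow> eval f (PrimRec g h) (0 # xs) y"
| eval_PrimRec_Suc: "eval f (PrimRec g h) (n # xs) y \<Longrightarrow> eval f h (n # y # xs) z \<Longrightarrow>
    eval f (PrimRec g h) (Suc n # xs) z"
| eval_Mu: "eval f g (n # xs) 0 \<Longrightarrow> \<forall>m < n. \<exists>y. eval f g (m # xs) (Suc y) \<Longrightarrow>
    eval f (Mu g) xs n"

inductive_cases eval_ZeroE: "eval f Zero xs y"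
inductive_cases eval_SuccE: "eval f Succ xs y"
inductive_cases eval_OracleE: "eval f Oracle xs y"
inductive_cases eval_ProjE: "eval f (Proj i) xs y"
inductive_cases eval_CompE: "eval f (Comp h gs) xs y"
inductive_cases eval_PrimRec_0E: "eval f (PrimRec g h) (0 # xs) y"
inductive_cases eval_PrimRec_SucE: "eval f (PrimRec g h) (Suc n # xs) y"
inductive_cases eval_MuE: "eval f (Mu g) xs y"

lemma eval_deterministic: "eval f e xs y \<Longrightarrow> eval f e xs z \<Longrightarrow> y = z"
proof (induction arbitrary: z rule: eval.induct)
  case (eval_Comp ys gs xs h w)
  from eval_Comp.prems obtain ys' where ys': "length ys' = length gs"
    "\<forall>i < length gs. eval f (gs ! i) xs (ys' ! i)" "eval f h ys' z"
    by (rule eval_CompE)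
  have "ys = ys'"
    using eval_Comp.hyps(1) eval_Comp.IH(1) ys'(1,2) by (intro nth_equalityI) simp_all
  then show ?case using eval_Comp.IH(2) ys'(3) by simp
next
  case (eval_PrimRec_Suc g h n xs y w)
  from eval_PrimRec_Suc.prems obtain y' where
    y': "eval f (PrimRec g h) (n # xs) y'" "eval f h (n # y' # xs) z"
    by (rule eval_PrimRec_SucE)
  show ?case using eval_PrimRec_Suc.IH(1)[OF y'(1)] eval_PrimRec_Suc.IH(2) y'(2) by simp
next
  case (eval_Mu g n xs)
  from eval_Mu.prems have z: "eval f g (z # xs) 0" "\<forall>m < z. \<exists>y. eval f g (m # xs) (Suc y)"
    by (auto elim: eval_MuE)
  show ?case
  proof (rule linorder_cases[of n z])
    assume "n < z"
    then obtain y where "eval f g (n # xs) (Suc y)" using z(2) by blast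
    then have "0 = Suc y" by (rule eval_Mu.IH(1))
    then show ?thesis by simp
  next
    assume "z < n"
    then obtain y where "\<And>v. eval f g (z # xs) v \<Longrightarrow> Suc y = v" using eval_Mu.IH(2) by blast
    from this[OF z(1)] show ?thesis by simp
  qed simp
qed (erule eval_ZeroE eval_SuccE eval_OracleE eval_ProjE eval_PrimRec_0E; simp)+

definition recursive_in :: "(nat \<Rightarrow> nat) \<Rightarrow> (nat \<Rightarrow> nat) \<Rightarrow> bool" where
  "recursive_in f g \<longleftrightarrow> (\<exists>e. \<forall>n. eval f e [n] (g n))"

definition recursive :: "(nat \<Rightarrow> nat) \<Rightarrow> bool" where
  "recursive g \<longleftrightarrow> recursive_in (\<lambda>_. 0) g"

definition re_in :: "(nat \<Rightarrow> nat) \<Rightarrow> nat set \<Rightarrow> bool" where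
  "re_in f A \<longleftrightarrow> (\<exists>e. A = {n. \<exists>y. eval f e [n] y})"

definition recursive_real :: "(nat \<Rightarrow> bool) \<Rightarrow> bool" where
  "recursive_real x \<longleftrightarrow> recursive (\<lambda>n. of_bool (x n))"

definition string_code :: "bool list \<Rightarrow> nat" where
  "string_code \<sigma> = list_encode (map of_bool \<sigma>)"

definition uniformly_re_in :: "(nat \<Rightarrow> nat) \<Rightarrow> (nat \<Rightarrow> bool list set) \<Rightarrow> bool" where
  "uniformly_re_in f U \<longleftrightarrow> re_in f {prod_encode (n, string_code \<sigma>) |n \<sigma>. \<sigma> \<in> U n}"

definition recursive_string_set :: "nat list set \<Rightarrow> bool" where
  "recursive_string_set T \<longleftrightarrow> recursive (\<lambda>n. of_bool (list_decode n \<in> T))"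

definition is_tree :: "nat list set \<Rightarrow> bool" where
  "is_tree T \<longleftrightarrow> (\<forall>\<sigma> \<tau>. \<sigma> @ \<tau> \<in> T \<longrightarrow> \<sigma> \<in> T)"

definition paths :: "nat list set \<Rightarrow> (nat \<Rightarrow> nat) set" where
  "paths T = {p. \<forall>n. map p [0..<n] \<in> T}"

definition recursively_bounded_branching :: "nat list set \<Rightarrow> bool" where
  "recursively_bounded_branching T \<longleftrightarrow>
     (\<exists>b. recursive b \<and> (\<forall>\<sigma> k. \<sigma> @ [k] \<in> T \<longrightarrow> k \<le> b (list_encode \<sigma>)))"

definition Pi01_class :: "(nat \<Rightarrow> nat) set \<Rightarrow> bool" where
  "Pi01_class P \<longleftrightarrow> (\<exists>S. recursive_string_set S \<and> is_tree S \<and> P = paths S)"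

text \<open>Cantor space is \<open>nat \<Rightarrow> bool\<close> with the product topology; \<open>borel\<close> is its Borel
  \<open>\<sigma>\<close>-algebra.\<close>

definition cylinder :: "bool list \<Rightarrow> (nat \<Rightarrow> bool) set" where
  "cylinder \<sigma> = {y. \<forall>i < length \<sigma>. y i = \<sigma> ! i}"

definition borel_prob :: "(nat \<Rightarrow> bool) measure \<Rightarrow> bool" where
  "borel_prob \<mu> \<longleftrightarrow> prob_space \<mu> \<and> sets \<mu> = sets borel"

definition continuous_measure :: "(nat \<Rightarrow> bool) measure \<Rightarrow> bool" where
  "continuous_measure \<mu> \<longleftrightarrow> borel_prob \<mu> \<and> (\<forall>y. measure \<mu> {y} = 0)"

text \<open>The index is shifted, so that the summand \<open>n\<close> below is the one for strings of length
  \<open>n + 1\<close>.\<close>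

definition measure_dist :: "(nat \<Rightarrow> bool) measure \<Rightarrow> (nat \<Rightarrow> bool) measure \<Rightarrow> real" where
  "measure_dist \<mu> \<nu> =
     (\<Sum>n. (1/2) ^ Suc n * (1/2 * (\<Sum>\<sigma> | length \<sigma> = Suc n.
        \<bar>measure \<mu> (cylinder \<sigma>) - measure \<nu> (cylinder \<sigma>)\<bar>)))"

definition pad_zeros :: "bool list \<Rightarrow> nat \<Rightarrow> bool" where
  "pad_zeros \<sigma> i \<longleftrightarrow> i < length \<sigma> \<and> \<sigma> ! i"

definition atomic_measure :: "bool list set \<Rightarrow> (bool list \<Rightarrow> rat) \<Rightarrow> (nat \<Rightarrow> bool) measure" where
  "atomic_measure \<Delta> Q = measure_of UNIV (sets borel)
     (\<lambda>A. \<Sum>\<sigma>\<in>\<Delta>. ennreal (of_rat (Q \<sigma>)) * emeasure (return borel (pad_zeros \<sigma>)) A)"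

lemma emeasure_atomic_measure:
  assumes "finite \<Delta>" "A \<in> sets borel"
  shows "emeasure (atomic_measure \<Delta> Q) A =
    (\<Sum>\<sigma>\<in>\<Delta>. ennreal (of_rat (Q \<sigma>)) * emeasure (return borel (pad_zeros \<sigma>)) A)"
  unfolding atomic_measure_def
proof (rule emeasure_measure_of_sigma)
  show "sigma_algebra UNIV (sets (borel :: (nat \<Rightarrow> bool) measure))"
    using sets.sigma_algebra_axioms[of borel] by simp
  show "positive (sets borel)
     (\<lambda>A. \<Sum>\<sigma>\<in>\<Delta>. ennreal (of_rat (Q \<sigma>)) * emeasure (return borel (pad_zeros \<sigma>)) A)"
    by (simp add: positive_def)
  show "countably_additive (sets borel)
     (\<lambda>A. \<Sum>\<sigma>\<in>\<Delta>. ennreal (of_rat (Q \<sigma>)) * emeasure (return borel (pad_zeros \<sigma>)) A)"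
  proof (rule countably_additiveI)
    fix B :: "nat \<Rightarrow> (nat \<Rightarrow> bool) set"
    assume B: "range B \<subseteq> sets borel" "disjoint_family B" "\<Union> (range B) \<in> sets borel"
    have "(\<Sum>i. \<Sum>\<sigma>\<in>\<Delta>. ennreal (of_rat (Q \<sigma>)) * emeasure (return borel (pad_zeros \<sigma>)) (B i)) =
       (\<Sum>\<sigma>\<in>\<Delta>. \<Sum>i. ennreal (of_rat (Q \<sigma>)) * emeasure (return borel (pad_zeros \<sigma>)) (B i))"
      by (rule suminf_sum) simp
    also have "\<dots> = (\<Sum>\<sigma>\<in>\<Delta>. ennreal (of_rat (Q \<sigma>)) *
        emeasure (return borel (pad_zeros \<sigma>)) (\<Union> (range B)))"
      using B by (intro sum.cong refl) (simp add: ennreal_suminf_cmult suminf_indicator)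
    finally show "(\<Sum>i. \<Sum>\<sigma>\<in>\<Delta>. ennreal (of_rat (Q \<sigma>)) *
        emeasure (return borel (pad_zeros \<sigma>)) (B i)) =
      (\<Sum>\<sigma>\<in>\<Delta>. ennreal (of_rat (Q \<sigma>)) * emeasure (return borel (pad_zeros \<sigma>)) (\<Union> (range B)))" .
  qed
qed (use assms in auto)

text \<open>
  The effective enumeration of the finitely supported measures with rational weights.  The index
  \<open>i\<close> codes a nonempty list of pairs of a string and a positive integer; the weight \<open>Q \<sigma>\<close> is
  the sum of the integers paired with \<open>\<sigma>\<close>, divided by the sum of all integers in the list.
\<close>

definition decode_entry :: "nat \<Rightarrow> bool list \<times> nat" where
  "decode_entry c = (case prod_decode c of (s, w) \<Rightarrow> (map (\<lambda>k. k \<noteq> 0) (list_decode s), Suc w))"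

definition decode_entries :: "nat \<Rightarrow> (bool list \<times> nat) list" where
  "decode_entries i =
     (case prod_decode i of (c, r) \<Rightarrow> map decode_entry (c # list_decode r))"

definition list_weight :: "(bool list \<times> nat) list \<Rightarrow> bool list \<Rightarrow> rat" where
  "list_weight es \<sigma> = of_nat (\<Sum>(\<tau>, w)\<leftarrow>es. if \<tau> = \<sigma> then w else 0) / of_nat (\<Sum>(\<tau>, w)\<leftarrow>es. w)"

definition dense_measure :: "nat \<Rightarrow> (nat \<Rightarrow> bool) measure" where
  "dense_measure i =
     (let es = decode_entries i in atomic_measure (fst ` set es) (list_weight es))"

lemma sum_list_if_eq_sum:
  "(\<Sum>\<sigma>\<in>fst ` set es. \<Sum>(\<tau>, w)\<leftarrow>es. if \<tau> = \<sigma> then w else 0) = (\<Sum>(\<tau>, w)\<leftarrow>es. w :: nat)"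
proof -
  have "(\<Sum>\<sigma>\<in>S. \<Sum>(\<tau>, w)\<leftarrow>es. if \<tau> = \<sigma> then w else 0) = (\<Sum>(\<tau>, w)\<leftarrow>es. w)"
    if "finite S" "fst ` set es \<subseteq> S" for S
    using that(2)
  proof (induction es)
    case (Cons e es)
    then show ?case using that(1) by (cases e) (auto simp: sum.distrib)
  qed simp
  then show ?thesis by simp
qed

lemma decode_entries_onto:
  assumes "es \<noteq> []" "\<forall>e\<in>set es. snd e > 0"
  shows "\<exists>i. decode_entries i = es"
proof -
  define enc where
    "enc e = prod_encode (list_encode (map of_bool (fst e)), snd e - 1)" for e :: "bool list \<times> nat"
  have enc: "decode_entry (enc e) = e" if "snd e > 0" for e
    using that by (cases e) (auto simp: enc_def decode_entry_def o_def)
  have "decode_entries (prod_encode (enc (hd es), list_encode (map enc (tl es)))) =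
      map decode_entry (map enc (hd es # tl es))"
    by (simp add: decode_entries_def)
  also have "\<dots> = map (\<lambda>e. e) es"
    unfolding list.collapse[OF assms(1)] map_map
    by (rule map_cong) (use assms(2) enc in auto)
  finally show ?thesis by auto
qed

lemma range_dense_measure:
  "range dense_measure =
     {atomic_measure \<Delta> Q |\<Delta> Q. finite \<Delta> \<and> (\<forall>\<sigma>\<in>\<Delta>. 0 \<le> Q \<sigma>) \<and> (\<Sum>\<sigma>\<in>\<Delta>. Q \<sigma>) = 1}"
  (is "_ = ?D")
proof
  show "range dense_measure \<subseteq> ?D"
  proof
    fix \<nu> assume "\<nu> \<in> range dense_measure"
    then obtain i where \<nu>: "\<nu> = dense_measure i" by auto
    define es where "es = decode_entries i"
    define total where "total = (\<Sum>(\<tau>, w)\<leftarrow>es. w)"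
    have "total > 0"
      by (auto simp: total_def es_def decode_entries_def decode_entry_def split: prod.split)
    have "(\<Sum>\<sigma>\<in>fst ` set es. list_weight es \<sigma>) =
        of_nat (\<Sum>\<sigma>\<in>fst ` set es. \<Sum>(\<tau>, w)\<leftarrow>es. if \<tau> = \<sigma> then w else 0) / of_nat total"
      by (simp only: list_weight_def total_def of_nat_sum sum_divide_distrib)
    also have "\<dots> = 1"
      using \<open>total > 0\<close> by (simp only: sum_list_if_eq_sum flip: total_def) simp
    finally have "(\<Sum>\<sigma>\<in>fst ` set es. list_weight es \<sigma>) = 1" .
    moreover have "\<forall>\<sigma>. 0 \<le> list_weight es \<sigma>"
      unfolding list_weight_def by (intro allI divide_nonneg_nonneg of_nat_0_le_iff)
    moreover have "\<nu> = atomic_measure (fst ` set es) (list_weight es)"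
      by (simp add: \<nu> dense_measure_def es_def Let_def)
    ultimately show "\<nu> \<in> ?D" by blast
  qed
  show "?D \<subseteq> range dense_measure"
  proof
    fix \<nu> assume "\<nu> \<in> ?D"
    then obtain \<Delta> Q where \<nu>: "\<nu> = atomic_measure \<Delta> Q"
      and fin: "finite \<Delta>" and nn: "\<forall>\<sigma>\<in>\<Delta>. 0 \<le> Q \<sigma>" and sum1: "(\<Sum>\<sigma>\<in>\<Delta>. Q \<sigma>) = 1"
      by auto
    define \<Delta>' where "\<Delta>' = {\<sigma>\<in>\<Delta>. Q \<sigma> \<noteq> 0}"
    have fin': "finite \<Delta>'" using fin by (simp add: \<Delta>'_def)
    have sum1': "(\<Sum>\<sigma>\<in>\<Delta>'. Q \<sigma>) = 1"
      unfolding sum1[symmetric] by (rule sum.mono_neutral_left) (auto simp: \<Delta>'_def fin)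
    define N where "N = (\<Prod>\<sigma>\<in>\<Delta>'. snd (quotient_of (Q \<sigma>)))"
    have N: "N > 0" unfolding N_def by (intro prod_pos) (simp add: quotient_of_denom_pos')
    have ex: "\<exists>w::nat. w > 0 \<and> of_nat w = Q \<sigma> * of_int N" if \<sigma>: "\<sigma> \<in> \<Delta>'" for \<sigma>
    proof -
      obtain a d where ad: "quotient_of (Q \<sigma>) = (a, d)" by (cases "quotient_of (Q \<sigma>)")
      have d: "d > 0" using ad by (rule quotient_of_denom_pos)
      have "d dvd N" using fin' \<sigma> ad unfolding N_def by (metis dvd_prodI snd_conv)
      then obtain k where k: "N = d * k" by blast
      have eq: "Q \<sigma> * of_int N = of_int (a * k)"
        using quotient_of_div[OF ad] d k by simp
      have "Q \<sigma> > 0" using \<sigma> nn by (auto simp: \<Delta>'_def less_le)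
      then have "Q \<sigma> * of_int N > 0" using N by simp
      then have "a * k > 0" unfolding eq by (simp only: of_int_0_less_iff)
      then show ?thesis
        by (intro exI[of _ "nat (a * k)"]) (simp add: eq)
    qed
    then obtain w :: "bool list \<Rightarrow> nat"
      where w: "\<And>\<sigma>. \<sigma> \<in> \<Delta>' \<Longrightarrow> w \<sigma> > 0 \<and> of_nat (w \<sigma>) = Q \<sigma> * of_int N" by metis
    obtain ss where ss: "set ss = \<Delta>'" "distinct ss"
      using finite_distinct_list[OF fin'] by blast
    define es where "es = map (\<lambda>\<sigma>. (\<sigma>, w \<sigma>)) ss"
    have "es \<noteq> []" using sum1' ss by (auto simp: es_def)
    moreover have "\<forall>e\<in>set es. snd e > 0" using w ss by (auto simp: es_def)
    ultimately obtain i where i: "decode_entries i = es" using decode_entries_onto by blast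
    have supp: "fst ` set es = \<Delta>'" using ss by (auto simp: es_def image_image)
    have "(\<Sum>(\<tau>, w)\<leftarrow>es. w) = (\<Sum>\<sigma>\<in>\<Delta>'. w \<sigma>)"
      using ss by (simp add: es_def o_def sum_list_distinct_conv_sum_set)
    then have "of_nat (\<Sum>(\<tau>, w)\<leftarrow>es. w) = (\<Sum>\<sigma>\<in>\<Delta>'. Q \<sigma> * of_int N)"
      using w by simp
    also have "\<dots> = of_int N" by (simp add: sum1' flip: sum_distrib_right)
    finally have total: "of_nat (\<Sum>(\<tau>, w)\<leftarrow>es. w) = (of_int N :: rat)" .
    have weight: "list_weight es \<sigma> = Q \<sigma>" if \<sigma>: "\<sigma> \<in> \<Delta>'" for \<sigma>
    proof -
      have "(\<Sum>(\<tau>, w)\<leftarrow>es. if \<tau> = \<sigma> then w else 0) = (\<Sum>\<tau>\<in>\<Delta>'. if \<tau> = \<sigma> then w \<tau> else 0)"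
        using ss by (simp add: es_def o_def sum_list_distinct_conv_sum_set)
      also have "\<dots> = w \<sigma>" using \<sigma> fin' by simp
      finally show ?thesis using w[OF \<sigma>] N by (simp add: list_weight_def total)
    qed
    have "dense_measure i = atomic_measure \<Delta>' (list_weight es)"
      by (simp add: dense_measure_def i supp Let_def)
    also have "\<dots> = atomic_measure \<Delta>' Q"
      unfolding atomic_measure_def using weight by (simp cong: sum.cong)
    also have "\<dots> = \<nu>"
    proof -
      have "(\<Sum>\<sigma>\<in>\<Delta>'. ennreal (of_rat (Q \<sigma>)) * emeasure (return borel (pad_zeros \<sigma>)) A) =
          (\<Sum>\<sigma>\<in>\<Delta>. ennreal (of_rat (Q \<sigma>)) * emeasure (return borel (pad_zeros \<sigma>)) A)" for A
        by (rule sum.mono_neutral_left) (auto simp: \<Delta>'_def fin)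
      then show ?thesis by (simp add: \<nu> atomic_measure_def)
    qed
    finally show "\<nu> \<in> range dense_measure" by (metis rangeI)
  qed
qed

text \<open>
  \<open>p\<close> codes the sequence of the measures \<open>dense_measure (p n)\<close>.  The sequences coded by members of
  a representation class converge with a recursive modulus common to the whole class; every
  convention for the rate of convergence (such as distance at most \<open>2 ^ (-n)\<close> between the terms
  \<open>n\<close> and \<open>n + 1\<close>) is an instance.
\<close>

definition represents :: "(nat \<Rightarrow> nat) \<Rightarrow> (nat \<Rightarrow> bool) measure \<Rightarrow> bool" where
  "represents p \<mu> \<longleftrightarrow> (\<lambda>n. measure_dist (dense_measure (p n)) \<mu>) \<longlonglongrightarrow> 0"

definition representation_class :: "(nat \<Rightarrow> nat) set \<Rightarrow> bool" where
  "representation_class P \<longleftrightarrow>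
     Pi01_class P \<and>
     (\<exists>T. recursive_string_set T \<and> is_tree T \<and> recursively_bounded_branching T \<and> P \<subseteq> paths T) \<and>
     (\<exists>g. recursive g \<and> (\<forall>p\<in>P. \<forall>k. \<forall>m \<ge> g k. \<forall>n \<ge> g k.
        measure_dist (dense_measure (p m)) (dense_measure (p n)) \<le> (1/2) ^ k)) \<and>
     (\<forall>\<mu>. borel_prob \<mu> \<longrightarrow> (\<exists>p\<in>P. represents p \<mu>))"

text \<open>In \<open>ennreal\<close> every family is summable, so the infinite sum below is the true sum, also when it
  is \<open>\<infinity>\<close>.\<close>

definition Martin_Loef_test ::
  "(nat \<Rightarrow> bool) measure \<Rightarrow> (nat \<Rightarrow> nat) \<Rightarrow> (nat \<Rightarrow> bool list set) \<Rightarrow> bool" where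
  "Martin_Loef_test \<mu> p U \<longleftrightarrow>
     uniformly_re_in p U \<and>
     (\<forall>n. (\<Sum>\<^sub>\<infinity>\<sigma>\<in>U n. emeasure \<mu> (cylinder \<sigma>)) \<le> ennreal ((1/2) ^ n))"

definition random_wrt :: "(nat \<Rightarrow> bool) measure \<Rightarrow> (nat \<Rightarrow> nat) \<Rightarrow> (nat \<Rightarrow> bool) \<Rightarrow> bool" where
  "random_wrt \<mu> p x \<longleftrightarrow>
     \<not> (\<exists>U. Martin_Loef_test \<mu> p U \<and> x \<in> (\<Inter>n. \<Union>\<sigma>\<in>U n. cylinder \<sigma>))"

end

theory Submission
  imports Defs
begin

text \<open>
  Every member \<open>x\<close> of a countable \<open>\<Pi>\<^sup>0\<^sub>1\<close> class fails to be random for every continuous measure: the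
  class is the intersection of a recursive decreasing sequence of clopen sets \<open>B m\<close>, a continuous
  measure \<open>\<mu>\<close> gives it measure \<open>0\<close>, and so a representation of \<open>\<mu>\<close> suffices to search for an \<open>m\<close>
  with \<open>\<mu> (B m) \<le> 2 ^ (-n)\<close>.  It remains to find a non-recursive member of such a class.  Let \<open>h\<close> be
  an injective recursive function with non-recursive range and let \<open>x\<close> be the set of its true stages,
  that is, of those \<open>t\<close> with \<open>h t < h u\<close> for all \<open>u > t\<close>.  From \<open>x\<close> one decides the range of \<open>h\<close>.
  On the other hand, \<open>x\<close> lies in the class of all \<open>y\<close> such that for every \<open>s\<close> in \<open>y\<close> the restriction
  of \<open>y\<close> to \<open>{0..s}\<close> is the set of stages that look true at \<open>s\<close>; the only infinite member of this class
  is \<open>x\<close>, and a finite member is determined by its maximum.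
\<close>

section \<open>Closure properties of relative computability\<close>

text \<open>A function of a variable assignment is computable if it is computed by a program that reads
  the first \<open>k\<close> variables, for all sufficiently large \<open>k\<close>.  Leaving the number of relevant variables
  open avoids all arity bookkeeping in the closure properties.\<close>

definition computable :: "(nat \<Rightarrow> nat) \<Rightarrow> ((nat \<Rightarrow> nat) \<Rightarrow> nat) \<Rightarrow> bool" where
  "computable f F \<longleftrightarrow> (\<exists>k0. \<forall>k\<ge>k0. \<exists>e. \<forall>v. eval f e (map v [0..<k]) (F v))"

definition decidable :: "(nat \<Rightarrow> nat) \<Rightarrow> ((nat \<Rightarrow> nat) \<Rightarrow> bool) \<Rightarrow> bool" where
  "decidable f P \<longleftrightarrow> computable f (\<lambda>v. of_bool (P v))"

named_theorems computable_intros

lemma map_upt_Suc': "map v [0..<Suc k] = v 0 # map (\<lambda>i. v (Suc i)) [0..<k]"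
  by (simp add: upt_conv_Cons map_Suc_upt[symmetric] o_def del: upt_Suc)

lemma computable_var [computable_intros]: "computable f (\<lambda>v. v i)"
proof -
  have "eval f (Proj i) (map v [0..<k]) (v i)" if "k \<ge> Suc i" for k v
    using that eval_Proj[of i "map v [0..<k]" f] by simp
  then show ?thesis unfolding computable_def by blast
qed

lemma computable_subst:
  assumes "computable f H" "\<And>i. computable f (A i)"
  shows "computable f (\<lambda>v. H (\<lambda>i. A i v))"
proof -
  obtain n h where h: "\<And>v. eval f h (map v [0..<n]) (H v)"
    using assms(1) unfolding computable_def by blast
  obtain K where K: "\<And>i k. k \<ge> K i \<Longrightarrow> \<exists>e. \<forall>v. eval f e (map v [0..<k]) (A i v)"
    using assms(2) unfolding computable_def by metis
  \<comment> \<open>The chosen program for \<open>H\<close> reads \<open>n\<close> variables, so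
    only finitely many thresholds \<open>K i\<close> matter, and their sum dominates each of
    them.\<close>
  have "\<exists>e. \<forall>v. eval f e (map v [0..<k]) (H (\<lambda>i. A i v))" if "k \<ge> (\<Sum>i<n. K i)" for k
  proof -
    have "k \<ge> K i" if "i < n" for i
      using that \<open>k \<ge> _\<close> member_le_sum[of i "{..<n}" K] by auto
    then have "\<forall>i. \<exists>e. i < n \<longrightarrow> (\<forall>v. eval f e (map v [0..<k]) (A i v))"
      using K by blast
    from choice[OF this] obtain E
      where E: "\<And>i v. i < n \<Longrightarrow> eval f (E i) (map v [0..<k]) (A i v)" by blast
    have "eval f (Comp h (map E [0..<n])) (map v [0..<k]) (H (\<lambda>i. A i v))" for v
      by (rule eval_Comp[of "map (\<lambda>i. A i v) [0..<n]"]) (auto intro: E h)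
    then show ?thesis by blast
  qed
  then show ?thesis unfolding computable_def by blast
qed

text \<open>Variable 0 acts as a bound variable and the surrounding assignment is shifted up by one,
  as with de Bruijn indices. All closure properties for binders below have this shape.\<close>

lemma computable_subst1:
  assumes "computable f (\<lambda>v. h (v 0) (\<lambda>i. v (Suc i)))" "computable f A"
  shows "computable f (\<lambda>v. h (A v) v)"
proof -
  have "computable f (case_nat A (\<lambda>i v. v i) i)" for i
    by (cases i) (simp_all add: assms(2) computable_var)
  from computable_subst[OF assms(1), where A = "case_nat A (\<lambda>i v. v i)", OF this]
  show ?thesis by simp
qed

lemma computable_shift:
  "computable f F \<Longrightarrow> computable f (\<lambda>v. F (\<lambda>i. v (Suc i)))"
  by (erule computable_subst) (rule computable_var)

lemma computable_Suc [computable_intros]: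
  assumes "computable f A" shows "computable f (\<lambda>v. Suc (A v))"
proof -
  have "computable f (\<lambda>v. Suc (v 0))"
    unfolding computable_def
  proof (intro exI allI impI)
    fix k v assume "Suc 0 \<le> k"
    then obtain k' where "k = Suc k'" by (cases k) auto
    then show "eval f Succ (map v [0..<k]) (Suc (v 0))"
      by (auto simp only: map_upt_Suc' intro: eval_Succ)
  qed
  then show ?thesis by (rule computable_subst1[of f "\<lambda>n _. Suc n"]) (rule assms)
qed

lemma computable_oracle:
  assumes "computable f A" shows "computable f (\<lambda>v. f (A v))"
proof -
  have "computable f (\<lambda>v. f (v 0))"
    unfolding computable_def
  proof (intro exI allI impI)
    fix k v assume "Suc 0 \<le> k"
    then obtain k' where "k = Suc k'" by (cases k) auto
    then show "eval f Oracle (map v [0..<k]) (f (v 0))"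
      by (auto simp only: map_upt_Suc' intro: eval_Oracle)
  qed
  then show ?thesis by (rule computable_subst1[of f "\<lambda>n _. f n"]) (rule assms)
qed

lemma computable_const [computable_intros]: "computable f (\<lambda>v. c)"
proof (induction c)
  case 0
  show ?case unfolding computable_def using eval_Zero by blast
qed (rule computable_Suc)

lemma computable_rec_nat:
  assumes "computable f G" "computable f (\<lambda>v. H (v 0) (v (Suc 0)) (\<lambda>i. v (Suc (Suc i))))"
    "computable f N"
  shows "computable f (\<lambda>v. rec_nat (G v) (\<lambda>n y. H n y v) (N v))"
proof -
  let ?R = "\<lambda>n v. rec_nat (G v) (\<lambda>n y. H n y v) n"
  obtain K1 where K1: "\<And>k. k \<ge> K1 \<Longrightarrow> \<exists>e. \<forall>v. eval f e (map v [0..<k]) (G v)"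
    using assms(1) unfolding computable_def by blast
  obtain K2 where K2: "\<And>k. k \<ge> K2 \<Longrightarrow> \<exists>e. \<forall>v. eval f e (map v [0..<k])
      (H (v 0) (v (Suc 0)) (\<lambda>i. v (Suc (Suc i))))"
    using assms(2) unfolding computable_def by blast
  \<comment> \<open>Besides the recursion variable there remain \<open>k' = k - 1\<close>
    parameters: the base program reads \<open>k'\<close> variables, the step program
    \<open>k' + 2\<close>, namely counter, previous value and parameters.\<close>
  have "\<exists>e. \<forall>v. eval f e (map v [0..<k]) (?R (v 0) (\<lambda>i. v (Suc i)))"
    if k: "k \<ge> Suc (K1 + K2)" for k
  proof -
    obtain k' where k': "k = Suc k'" using k by (cases k) auto
    obtain g where g: "\<And>v. eval f g (map v [0..<k']) (G v)" using K1[of k'] k k' by auto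
    obtain h where h: "\<And>v. eval f h (map v [0..<Suc (Suc k')])
        (H (v 0) (v (Suc 0)) (\<lambda>i. v (Suc (Suc i))))"
      using K2[of "Suc (Suc k')"] k k' by auto
    have "eval f (PrimRec g h) (n # map v [0..<k']) (?R n v)" for n v
    proof (induction n)
      case (Suc n)
      have "eval f h (n # ?R n v # map v [0..<k']) (H n (?R n v) v)"
        using h[of "case_nat n (case_nat (?R n v) v)"] by (simp only: map_upt_Suc') simp
      with Suc show ?case by (auto intro: eval_PrimRec_Suc)
    qed (auto intro: eval_PrimRec_0 g)
    then show ?thesis by (auto simp only: k' map_upt_Suc')
  qed
  then have "computable f (\<lambda>v. ?R (v 0) (\<lambda>i. v (Suc i)))" unfolding computable_def by blast
  then show ?thesis by (rule computable_subst1) (rule assms(3))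
qed

lemma computable_Least_zero:
  assumes "computable f (\<lambda>v. G (v 0) (\<lambda>i. v (Suc i)))" "\<And>v. \<exists>n. G n v = 0"
  shows "computable f (\<lambda>v. LEAST n. G n v = 0)"
proof -
  obtain K where K: "\<And>k. k \<ge> K \<Longrightarrow> \<exists>e. \<forall>v. eval f e (map v [0..<k]) (G (v 0) (\<lambda>i. v (Suc i)))"
    using assms(1) unfolding computable_def by blast
  have "\<exists>e. \<forall>v. eval f e (map v [0..<k]) (LEAST n. G n v = 0)" if "k \<ge> K" for k
  proof -
    obtain g where g: "\<And>v. eval f g (map v [0..<Suc k]) (G (v 0) (\<lambda>i. v (Suc i)))"
      using K[of "Suc k"] \<open>k \<ge> K\<close> by auto
    have g': "eval f g (n # map v [0..<k]) (G n v)" for n v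
      using g[of "case_nat n v"] by (simp only: map_upt_Suc') simp
    have "eval f (Mu g) (map v [0..<k]) (LEAST n. G n v = 0)" for v
    proof (rule eval_Mu)
      have "G (LEAST n. G n v = 0) v = 0" using assms(2) by (rule LeastI_ex)
      then show "eval f g ((LEAST n. G n v = 0) # map v [0..<k]) 0" by (metis g')
      show "\<forall>m<LEAST n. G n v = 0. \<exists>y. eval f g (m # map v [0..<k]) (Suc y)"
      proof (intro allI impI)
        fix m assume "m < (LEAST n. G n v = 0)"
        then have "G m v \<noteq> 0" by (rule not_less_Least)
        then obtain y where "G m v = Suc y" by (cases "G m v") auto
        then show "\<exists>y. eval f g (m # map v [0..<k]) (Suc y)" using g'[of m v] by auto
      qed
    qed
    then show ?thesis by blast
  qed
  then show ?thesis unfolding computable_def by blast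
qed


section \<open>Arithmetic by primitive recursion\<close>

lemma computable_add [computable_intros]:
  assumes "computable f A" "computable f B" shows "computable f (\<lambda>v. A v + B v)"
proof -
  have "a + b = rec_nat a (\<lambda>_ y. Suc y) b" for a b :: nat by (induction b) simp_all
  then show ?thesis by (simp only:) (intro computable_rec_nat computable_intros assms)
qed


lemma computable_mult [computable_intros]:
  assumes "computable f A" "computable f B" shows "computable f (\<lambda>v. A v * B v)"
proof -
  have "a * b = rec_nat 0 (\<lambda>_ y. y + a) b" for a b :: nat by (induction b) simp_all
  then show ?thesis
    by (simp only:) (intro computable_rec_nat computable_intros assms
        assms[THEN computable_shift, THEN computable_shift])
qed

lemma computable_diff [computable_intros]:
  assumes "computable f A" "computable f B" shows "computable f (\<lambda>v. A v - B v)"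
proof -
  \<comment> \<open>The predecessor is a recursion that returns its counter and ignores the previous
    value; truncated subtraction iterates it.\<close>
  have "n - Suc 0 = rec_nat 0 (\<lambda>n _. n) n" for n by (cases n) simp_all
  moreover have "computable f (\<lambda>v. rec_nat 0 (\<lambda>n _. n) (C v))" if "computable f C" for C
    by (intro computable_rec_nat computable_intros that)
  ultimately have pred: "computable f (\<lambda>v. C v - Suc 0)" if "computable f C" for C
    using that by simp
  have "a - b = rec_nat a (\<lambda>_ y. y - Suc 0) b" for a b :: nat by (induction b) simp_all
  from this[of "A _" "B _"] show ?thesis
    by (simp only:) (intro computable_rec_nat pred computable_intros assms)
qed

lemma computable_power [computable_intros]:
  assumes "computable f A" "computable f B" shows "computable f (\<lambda>v. A v ^ B v)"
proof -
  have "a ^ b = rec_nat 1 (\<lambda>_ y. y * a) b" for a b :: nat by (induction b) simp_all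
  then show ?thesis
    by (simp only:) (intro computable_rec_nat computable_intros assms
        assms[THEN computable_shift, THEN computable_shift])
qed

lemma computable_sum [computable_intros]:
  assumes "computable f (\<lambda>v. F (v 0) (\<lambda>i. v (Suc i)))" "computable f N"
  shows "computable f (\<lambda>v. \<Sum>i<N v. F i v)"
proof -
  have "(\<Sum>i<n. F i v) = rec_nat 0 (\<lambda>i y. y + F i v) n" for n v by (induction n) simp_all
  moreover have "computable f (\<lambda>v. F (v 0) (\<lambda>i. v (Suc (Suc i))))"
  proof -
    \<comment> \<open>Inside the recursion variable 1 holds the partial sum; this renaming makes
      \<open>F\<close> skip it.\<close>
    let ?A = "\<lambda>i v. v (case_nat 0 (\<lambda>j. Suc (Suc j)) i)"
    from computable_subst[OF assms(1), where A = ?A, OF computable_var]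
    show ?thesis by simp
  qed
  ultimately show ?thesis
    by (simp only:) (intro computable_rec_nat computable_add computable_const computable_var assms)
qed

section \<open>Decidable predicates, bounded quantifiers and search\<close>

lemma computable_of_bool [computable_intros]:
  "decidable f P \<Longrightarrow> computable f (\<lambda>v. of_bool (P v))"
  by (simp add: decidable_def)

lemma decidable_le [computable_intros]:
  assumes "computable f A" "computable f B" shows "decidable f (\<lambda>v. A v \<le> B v)"
proof -
  have "of_bool (a \<le> b) = 1 - (a - b)" for a b :: nat by simp
  then show ?thesis unfolding decidable_def by (simp only:) (intro computable_intros assms)
qed

lemma decidable_not [computable_intros]:
  assumes "decidable f P" shows "decidable f (\<lambda>v. \<not> P v)"
proof -
  have "of_bool (\<not> p) = 1 - (of_bool p :: nat)" for p by simp
  then show ?thesis unfolding decidable_def by (simp only:) (intro computable_intros assms)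
qed

lemma decidable_conj [computable_intros]:
  assumes "decidable f P" "decidable f Q" shows "decidable f (\<lambda>v. P v \<and> Q v)"
  unfolding decidable_def of_bool_conj by (intro computable_intros assms)

lemma decidable_disj [computable_intros]:
  assumes "decidable f P" "decidable f Q" shows "decidable f (\<lambda>v. P v \<or> Q v)"
proof -
  have "(p \<or> q) = (\<not> (\<not> p \<and> \<not> q))" for p q by simp
  then show ?thesis by (simp only:) (intro computable_intros assms)
qed

lemma decidable_imp [computable_intros]:
  assumes "decidable f P" "decidable f Q" shows "decidable f (\<lambda>v. P v \<longrightarrow> Q v)"
  unfolding imp_conv_disj by (intro computable_intros assms)

lemma decidable_iff [computable_intros]:
  assumes "decidable f P" "decidable f Q" shows "decidable f (\<lambda>v. P v \<longleftrightarrow> Q v)"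
  unfolding iff_conv_conj_imp by (intro computable_intros assms)

lemma decidable_less [computable_intros]:
  assumes "computable f A" "computable f B" shows "decidable f (\<lambda>v. A v < B v)"
  unfolding not_le[symmetric] by (intro computable_intros assms)

lemma decidable_eq [computable_intros]:
  assumes "computable f A" "computable f B" shows "decidable f (\<lambda>v. A v = B v)"
  unfolding order_eq_iff by (intro computable_intros assms)

lemma computable_if [computable_intros]:
  assumes "decidable f P" "computable f A" "computable f B"
  shows "computable f (\<lambda>v. if P v then A v else B v)"
proof -
  have "(if p then a else b) = of_bool p * a + of_bool (\<not> p) * b" for p and a b :: nat
    by (cases p) simp_all
  then show ?thesis by (simp only:) (intro computable_intros assms)
qed

lemma decidable_ex_less [computable_intros]:
  assumes "decidable f (\<lambda>v. P (v 0) (\<lambda>i. v (Suc i)))" "computable f N"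
  shows "decidable f (\<lambda>v. \<exists>i<N v. P i v)"
proof -
  have "(\<exists>i<n. P i v) \<longleftrightarrow> 0 < (\<Sum>i<n. of_bool (P i v) :: nat)" for n v
    by (induction n) (auto simp: less_Suc_eq simp del: sum_of_bool_eq)
  then show ?thesis by (simp only:) (intro computable_intros assms)
qed

lemma decidable_all_less [computable_intros]:
  assumes "decidable f (\<lambda>v. P (v 0) (\<lambda>i. v (Suc i)))" "computable f N"
  shows "decidable f (\<lambda>v. \<forall>i<N v. P i v)"
proof -
  have "(\<forall>i<n. Q i) \<longleftrightarrow> \<not> (\<exists>i<n. \<not> Q i)" for Q and n :: nat by auto
  then show ?thesis by (simp only:) (intro computable_intros assms)
qed

lemma computable_Least:
  assumes "decidable f (\<lambda>v. P (v 0) (\<lambda>i. v (Suc i)))" "\<And>v. \<exists>n. P n v"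
  shows "computable f (\<lambda>v. LEAST n. P n v)"
proof -
  have "computable f (\<lambda>v. LEAST n. of_bool (\<not> P n v) = (0::nat))"
    by (rule computable_Least_zero) (use assms in \<open>auto intro!: computable_intros\<close>)
  then show ?thesis by simp
qed

lemma decidable_subst1:
  assumes "decidable f (\<lambda>v. P (v 0))" "computable f A" shows "decidable f (\<lambda>v. P (A v))"
  using assms unfolding decidable_def by (rule computable_subst1)

lemma computable_subst2:
  assumes "computable f (\<lambda>v. h (v 0) (v (Suc 0)))" "computable f A" "computable f B"
  shows "computable f (\<lambda>v. h (A v) (B v))"
proof -
  have "computable f (case_nat A (\<lambda>i v. B v) i)" for i
    by (cases i) (simp_all add: assms)
  from computable_subst[OF assms(1), where A = "case_nat A (\<lambda>i v. B v)", OF this]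
  show ?thesis by simp
qed

lemma decidable_subst2:
  assumes "decidable f (\<lambda>v. P (v 0) (v (Suc 0)))" "computable f A" "computable f B"
  shows "decidable f (\<lambda>v. P (A v) (B v))"
  using assms unfolding decidable_def by (rule computable_subst2)

section \<open>Codes of pairs and lists\<close>

lemma computable_triangle [computable_intros]:
  assumes "computable f A" shows "computable f (\<lambda>v. triangle (A v))"
proof -
  have "triangle n = (\<Sum>i<n. Suc i)" for n by (induction n) simp_all
  then show ?thesis by (simp only:) (intro computable_intros assms)
qed

lemma computable_prod_encode [computable_intros]:
  assumes "computable f A" "computable f B" shows "computable f (\<lambda>v. prod_encode (A v, B v))"
  unfolding prod_encode_def prod.case by (intro computable_intros assms)

text \<open>The pairing is inverted by search. The second component is at most the code, so the
  condition on the first one involves only a bounded quantifier; once the first is known, the second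
  is found by a search of its own.\<close>

lemma computable_fst_prod_decode [computable_intros]:
  assumes "computable f A" shows "computable f (\<lambda>v. fst (prod_decode (A v)))"
proof -
  have ex: "\<exists>a. \<exists>b<Suc n. prod_encode (a, b) = n" for n
  proof (intro exI conjI)
    show "snd (prod_decode n) < Suc n"
      using le_prod_encode_2[of "snd (prod_decode n)" "fst (prod_decode n)"]
      by (simp add: less_Suc_eq_le)
    show "prod_encode (fst (prod_decode n), snd (prod_decode n)) = n" by simp
  qed
  have "fst (prod_decode n) = (LEAST a. \<exists>b<Suc n. prod_encode (a, b) = n)" for n
    by (rule Least_equality[symmetric]) (use ex[of n] in auto)
  then show ?thesis
    by (simp only:) (intro computable_Least computable_intros assms ex assms[THEN computable_shift]
        assms[THEN computable_shift, THEN computable_shift])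
qed

lemma computable_snd_prod_decode [computable_intros]:
  assumes "computable f A" shows "computable f (\<lambda>v. snd (prod_decode (A v)))"
proof -
  have ex: "\<exists>b. prod_encode (fst (prod_decode n), b) = n" for n
    by (intro exI[of _ "snd (prod_decode n)"]) simp
  have "snd (prod_decode n) = (LEAST b. prod_encode (fst (prod_decode n), b) = n)" for n
  proof (rule Least_equality[symmetric])
    fix b assume "prod_encode (fst (prod_decode n), b) = n"
    then have "prod_decode n = (fst (prod_decode n), b)" by (metis prod_encode_inverse)
    then show "snd (prod_decode n) \<le> b" by (cases "prod_decode n") simp
  qed simp
  then show ?thesis
    by (simp only:) (intro computable_Least computable_intros assms ex assms[THEN computable_shift]
        assms[THEN computable_shift, THEN computable_shift])
qed

lemma prod_decode_0: "prod_decode 0 = (0, 0)"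
  using prod_encode_inverse[of "(0, 0)"] by (simp add: prod_encode_def)

text \<open>A nonempty list is coded by the successor of a pair of head and tail. For the empty
  list, truncated predecessor and \<open>prod_decode 0 = (0, 0)\<close> return the code 0, in
  agreement with \<open>tl [] = []\<close>.\<close>

lemma list_decode_tl: "list_decode (snd (prod_decode (n - Suc 0))) = tl (list_decode n)"
  by (cases n) (simp_all add: prod_decode_0 split: prod.split)

lemma computable_drop [computable_intros]:
  assumes "computable f A" "computable f B"
  shows "computable f (\<lambda>v. list_encode (drop (B v) (list_decode (A v))))"
proof -
  have eq: "list_decode (rec_nat c (\<lambda>_ y. snd (prod_decode (y - Suc 0))) n) =
      drop n (list_decode c)" for c n
    by (induction n) (simp_all add: list_decode_tl drop_Suc tl_drop)
  have "list_encode (drop n (list_decode c)) =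
      rec_nat c (\<lambda>_ y. snd (prod_decode (y - Suc 0))) n" for c n
    unfolding eq[symmetric] by (rule list_decode_inverse)
  then show ?thesis by (simp only:) (intro computable_rec_nat computable_intros assms)
qed

lemma list_encode_eq_0_iff: "list_encode xs = 0 \<longleftrightarrow> xs = []"
  by (cases xs) auto

text \<open>Found by search: the least number of elements whose removal leaves the code 0 of the
  empty list.\<close>

lemma computable_length [computable_intros]:
  assumes "computable f A" shows "computable f (\<lambda>v. length (list_decode (A v)))"
proof -
  have ex: "\<exists>n. list_encode (drop n (list_decode c)) = 0" for c
    by (rule exI[of _ "length (list_decode c)"]) (simp add: list_encode_eq_0_iff)
  have "length (list_decode c) = (LEAST n. list_encode (drop n (list_decode c)) = 0)" for c
    by (rule Least_equality[symmetric]) (simp_all add: list_encode_eq_0_iff)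
  then show ?thesis
    by (simp only:) (intro computable_Least computable_intros assms ex assms[THEN computable_shift]
        assms[THEN computable_shift, THEN computable_shift])
qed

text \<open>The default 0 makes access total and at the same time realises the padding of strings by
  zeros.\<close>

abbreviation entry :: "nat \<Rightarrow> nat \<Rightarrow> nat" where
  "entry c i \<equiv> nth_default 0 (list_decode c) i"

lemma computable_entry [computable_intros]:
  assumes "computable f A" "computable f B" shows "computable f (\<lambda>v. entry (A v) (B v))"
proof -
  have "entry c i = fst (prod_decode (list_encode (drop i (list_decode c)) - Suc 0))" for c i
  proof (cases "i < length (list_decode c)")
    case True
    then show ?thesis by (simp add: nth_default_nth Cons_nth_drop_Suc[symmetric])
  next
    case False
    then show ?thesis by (simp add: nth_default_beyond prod_decode_0)
  qed
  then show ?thesis by (simp only:) (intro computable_intros assms)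
qed

lemma decidable_bex_list [computable_intros]:
  assumes "decidable f (\<lambda>v. P (v 0) (\<lambda>i. v (Suc i)))" "computable f A"
  shows "decidable f (\<lambda>v. \<exists>x\<in>set (list_decode (A v)). P x v)"
proof -
  have "(\<exists>x\<in>set (list_decode c). P x v) \<longleftrightarrow> (\<exists>i<length (list_decode c). P (entry c i) v)" for c v
    by (metis in_set_conv_nth nth_default_nth)
  moreover have "decidable f (\<lambda>v. P (entry (A (\<lambda>i. v (Suc i))) (v 0)) (\<lambda>i. v (Suc i)))"
  proof -
    let ?B = "\<lambda>v. entry (A (\<lambda>i. v (Suc i))) (v 0)"
    have "computable f (case_nat ?B (\<lambda>i v. v (Suc i)) i)" for i
      by (cases i) (simp_all add: computable_entry computable_shift[OF assms(2)] computable_var)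
    from computable_subst[OF assms(1)[unfolded decidable_def],
        where A = "case_nat ?B (\<lambda>i v. v (Suc i))", OF this]
    show ?thesis by (simp add: decidable_def)
  qed
  ultimately show ?thesis by (simp only:) (intro computable_intros assms)
qed

section \<open>Passing between programs and functions of assignments\<close>

lemma recursive_inI:
  assumes "computable f (\<lambda>v. g (v 0))" shows "recursive_in f g"
proof -
  obtain k :: nat and e where e: "\<And>v. eval f e (map v [0..<Suc k]) (g (v 0))"
    using assms unfolding computable_def by (metis le_Suc_eq order_refl)
  have "eval f (Comp e (Proj 0 # replicate k Zero)) [n] (g n)" for n
  proof (rule eval_Comp)
    show "length (n # replicate k 0) = length (Proj 0 # replicate k Zero)" by simp
    show "\<forall>i<length (Proj 0 # replicate k Zero).
        eval f ((Proj 0 # replicate k Zero) ! i) [n] ((n # replicate k 0) ! i)"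
      using eval_Proj[of 0 "[n]" f] by (auto simp: nth_Cons split: nat.split intro: eval_Zero)
    have "map (case_nat n (\<lambda>_. 0)) [0..<Suc k] = n # replicate k 0"
      unfolding map_upt_Suc' by (simp add: map_replicate_const)
    then show "eval f e (n # replicate k 0) (g n)"
      using e[of "case_nat n (\<lambda>_. 0)"] by simp
  qed
  then show ?thesis unfolding recursive_in_def by blast
qed

lemma computable_recursive_in:
  assumes "recursive_in f g" "computable f A" shows "computable f (\<lambda>v. g (A v))"
proof -
  obtain e where e: "\<And>n. eval f e [n] (g n)" using assms(1) unfolding recursive_in_def by blast
  have "computable f (\<lambda>v. g (v 0))"
    unfolding computable_def
  proof (intro exI allI impI)
    fix k :: nat and v assume "1 \<le> k"
    then have "eval f (Proj 0) (map v [0..<k]) (v 0)"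
      using eval_Proj[of 0 "map v [0..<k]" f] by simp
    then show "eval f (Comp e [Proj 0]) (map v [0..<k]) (g (v 0))"
      by (intro eval_Comp[where ys = "[v 0]"]) (simp_all add: e)
  qed
  then show ?thesis by (rule computable_subst1[where h = "\<lambda>n _. g n"]) (rule assms)
qed

text \<open>Every oracle call is replaced by a program for the constant 0, the answer of the zero
  oracle; the translation then behaves in the same way under any oracle.\<close>

lemma recursive_imp_recursive_in:
  assumes "recursive g" shows "recursive_in f g"
proof -
  define relativize where
    "relativize = rec_prog Zero Succ (Comp Zero []) Proj (\<lambda>_ gs h'. Comp h' (map snd gs))
       (\<lambda>_ _ g' h'. PrimRec g' h') (\<lambda>_ g'. Mu g')"
  have "eval f (relativize e) xs y" if "eval (\<lambda>_. 0) e xs y" for e xs y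
    using that
  proof (induction rule: eval.induct)
    case (eval_Comp ys gs xs h z)
    then show ?case by (auto simp: relativize_def intro!: eval.eval_Comp[of ys])
  next
    case (eval_Oracle x xs)
    then show ?case by (auto simp: relativize_def intro!: eval.eval_Comp[of "[]"] eval_Zero)
  qed (auto simp: relativize_def intro: eval.intros)
  then show ?thesis using assms unfolding recursive_def recursive_in_def by blast
qed

lemmas computable_recursive = computable_recursive_in[OF recursive_imp_recursive_in]

text \<open>Minimisation over a dummy variable 0, on which the test does not depend, halts exactly
  on the members of \<open>A\<close>.\<close>

lemma re_inI:
  assumes "decidable f (\<lambda>v. v 0 \<in> A)" shows "re_in f A"
proof -
  have "computable f (\<lambda>v. of_bool (v (Suc 0) \<notin> A))"
    by (intro computable_intros decidable_subst1[OF assms])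
  then obtain k e where e: "\<And>v. eval f e (map v [0..<Suc (Suc k)]) (of_bool (v (Suc 0) \<notin> A))"
    unfolding computable_def by (metis le_Suc_eq order_refl)
  let ?e = "Comp e (Proj 0 # Proj 1 # replicate k Zero)"
  have ev: "eval f ?e [m, n] (of_bool (n \<notin> A))" for m n
  proof (rule eval_Comp)
    show "length (m # n # replicate k 0) = length (Proj 0 # Proj 1 # replicate k Zero)" by simp
    show "\<forall>i<length (Proj 0 # Proj 1 # replicate k Zero).
        eval f ((Proj 0 # Proj 1 # replicate k Zero) ! i) [m, n] ((m # n # replicate k 0) ! i)"
      using eval_Proj[of 0 "[m, n]" f] eval_Proj[of 1 "[m, n]" f]
      by (auto simp: nth_Cons split: nat.split intro: eval_Zero)
    have "map (case_nat m (case_nat n (\<lambda>_. 0))) [0..<Suc (Suc k)] = m # n # replicate k 0"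
      unfolding map_upt_Suc' by (simp add: map_replicate_const)
    then show "eval f e (m # n # replicate k 0) (of_bool (n \<notin> A))"
      using e[of "case_nat m (case_nat n (\<lambda>_. 0))"] by simp
  qed
  have "(\<exists>y. eval f (Mu ?e) [n] y) \<longleftrightarrow> n \<in> A" for n
  proof
    assume "n \<in> A"
    then show "\<exists>y. eval f (Mu ?e) [n] y" using ev[of 0 n] by (intro exI[of _ 0] eval_Mu) simp_all
  next
    assume "\<exists>y. eval f (Mu ?e) [n] y"
    then obtain y where "eval f ?e [y, n] 0" by (auto elim: eval_MuE)
    from eval_deterministic[OF this ev] show "n \<in> A" by (simp split: if_splits)
  qed
  then show ?thesis unfolding re_in_def by (intro exI[of _ "Mu ?e"]) blast
qed

section \<open>Derivations of halting computations\<close>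

primrec prog_code :: "prog \<Rightarrow> nat" where
  "prog_code Zero = prod_encode (0, 0)"
| "prog_code Succ = prod_encode (1, 0)"
| "prog_code Oracle = prod_encode (2, 0)"
| "prog_code (Proj i) = prod_encode (3, i)"
| "prog_code (Comp h gs) = prod_encode (4, prod_encode (prog_code h, list_encode (map prog_code gs)))"
| "prog_code (PrimRec g h) = prod_encode (5, prod_encode (prog_code g, prog_code h))"
| "prog_code (Mu g) = prod_encode (6, prog_code g)"

text \<open>\<open>judgement e c y\<close> states that the program with code \<open>e\<close>, run on the argument list with code
  \<open>c\<close>, outputs \<open>y\<close>.\<close>

definition judgement :: "nat \<Rightarrow> nat \<Rightarrow> nat \<Rightarrow> nat" where
  "judgement e c y = prod_encode (e, prod_encode (c, y))"

definition subject :: "nat \<Rightarrow> nat" where "subject J = fst (prod_decode J)"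
definition args :: "nat \<Rightarrow> nat" where "args J = fst (prod_decode (snd (prod_decode J)))"
definition result :: "nat \<Rightarrow> nat" where "result J = snd (prod_decode (snd (prod_decode J)))"

lemma judgement_simps [simp]:
  "subject (judgement e c y) = e" "args (judgement e c y) = c" "result (judgement e c y) = y"
  by (simp_all add: judgement_def subject_def args_def result_def)

definition cons_code :: "nat \<Rightarrow> nat \<Rightarrow> nat" where "cons_code x c = Suc (prod_encode (x, c))"
definition hd_code :: "nat \<Rightarrow> nat" where "hd_code c = fst (prod_decode (c - Suc 0))"
definition tl_code :: "nat \<Rightarrow> nat" where "tl_code c = snd (prod_decode (c - Suc 0))"

lemma cons_code [simp]:
  "list_decode (cons_code x c) = x # list_decode c"
  "hd_code (cons_code x c) = x" "tl_code (cons_code x c) = c" "cons_code x c > 0"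
  by (simp_all add: cons_code_def hd_code_def tl_code_def)

lemma list_decode_pos: "c > 0 \<Longrightarrow> list_decode c = hd_code c # list_decode (tl_code c)"
  by (cases c) (simp_all add: hd_code_def tl_code_def split: prod.split)

text \<open>The clauses mirror the rules of \<open>eval\<close> for the zero oracle, sorted by the
  constructor tag \<open>t\<close>. Intermediate values, such as the arguments of the outer program
  of a composition, are read off judgements in \<open>S\<close>, so all quantifiers are bounded once
  \<open>S\<close> is a coded list.\<close>

definition justified :: "nat set \<Rightarrow> nat \<Rightarrow> bool" where
  "justified S J \<longleftrightarrow>
     (let e = subject J; t = fst (prod_decode e); p = snd (prod_decode e);
          p1 = fst (prod_decode p); p2 = snd (prod_decode p); c = args J; y = result J
      in t = 0 \<and> y = 0
       \<or> t = 1 \<and> c > 0 \<and> y = Suc (hd_code c)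
       \<or> t = 2 \<and> c > 0 \<and> y = 0
       \<or> t = 3 \<and> p < length (list_decode c) \<and> y = entry c p
       \<or> t = 4 \<and> (\<exists>J'\<in>S. subject J' = p1 \<and> result J' = y \<and>
            length (list_decode (args J')) = length (list_decode p2) \<and>
            (\<forall>i<length (list_decode p2). judgement (entry p2 i) c (entry (args J') i) \<in> S))
       \<or> t = 5 \<and> c > 0 \<and> hd_code c = 0 \<and> judgement p1 (tl_code c) y \<in> S
       \<or> t = 5 \<and> c > 0 \<and> hd_code c > 0 \<and>
            (\<exists>J'\<in>S. subject J' = e \<and> args J' = cons_code (hd_code c - 1) (tl_code c) \<and>
              judgement p2 (cons_code (hd_code c - 1) (cons_code (result J') (tl_code c))) y \<in> S)
       \<or> t = 6 \<and> judgement p (cons_code y c) 0 \<in> S \<and>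
            (\<forall>m<y. \<exists>J'\<in>S. subject J' = p \<and> args J' = cons_code m c \<and> result J' > 0))"

text \<open>The set occurs only positively in the clauses.\<close>

lemma justified_mono:
  assumes "S \<subseteq> S'" shows "justified S J \<longrightarrow> justified S' J"
proof -
  have bex: "(\<exists>J\<in>S. P J) \<longrightarrow> (\<exists>J\<in>S'. Q J)" if "\<And>J. P J \<longrightarrow> Q J" for P Q
    using assms that by blast
  show ?thesis unfolding justified_def Let_def
    by (intro imp_refl disj_mono conj_mono all_mono imp_mono bex in_mono[OF assms])
qed

text \<open>A derivation lists every judgement in front of the judgements that justify it.\<close>

primrec derivation :: "nat list \<Rightarrow> bool" where
  "derivation [] \<longleftrightarrow> True"
| "derivation (J # L) \<longleftrightarrow> justified (set L) J \<and> derivation L"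

text \<open>A judgement about a number that codes no program is vacuously true, so soundness can be
  stated for arbitrary numbers.\<close>

definition true_judgement :: "nat \<Rightarrow> bool" where
  "true_judgement J \<longleftrightarrow>
     (\<forall>q. prog_code q = subject J \<longrightarrow> eval (\<lambda>_. 0) q (list_decode (args J)) (result J))"

lemma eval_Comp': "length ys = length gs \<Longrightarrow> (\<And>i. i < length gs \<Longrightarrow> eval f (gs ! i) xs (ys ! i)) \<Longrightarrow>
    eval f h ys z \<Longrightarrow> eval f (Comp h gs) xs z"
  by (rule eval_Comp) auto

lemma justified_sound:
  assumes "justified S J" "\<forall>J\<in>S. true_judgement J" shows "true_judgement J"
  unfolding true_judgement_def
proof (intro allI impI)
  fix q assume q: "prog_code q = subject J"
  have S: "eval (\<lambda>_. 0) q' (list_decode c) y" if "judgement (prog_code q') c y \<in> S" for q' c y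
    using assms(2) that by (force simp: true_judgement_def)
  have S': "eval (\<lambda>_. 0) q' (list_decode (args J')) (result J')"
    if "J' \<in> S" "subject J' = prog_code q'" for q' J'
    using assms(2) that by (force simp: true_judgement_def)
  note just = assms(1)[unfolded justified_def Let_def, folded q]
  show "eval (\<lambda>_. 0) q (list_decode (args J)) (result J)"
  proof (cases q)
    case Zero
    then show ?thesis using just by (auto intro: eval.intros)
  next
    case Succ
    then have "args J > 0" "result J = Suc (hd_code (args J))" using just by auto
    then show ?thesis unfolding Succ by (simp add: list_decode_pos eval_Succ)
  next
    case Oracle
    then have "args J > 0" "result J = 0" using just by auto
    then show ?thesis unfolding Oracle using eval_Oracle[of "\<lambda>_. 0"]
      by (simp add: list_decode_pos)
  next
    case (Proj i)
    then show ?thesis using just by (auto simp: nth_default_nth intro: eval.intros)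
  next
    case (Comp h gs)
    then obtain J' where J': "J' \<in> S" "subject J' = prog_code h" "result J' = result J"
      "length (list_decode (args J')) = length gs"
      "\<And>i. i < length gs \<Longrightarrow> judgement (prog_code (gs ! i)) (args J) (list_decode (args J') ! i) \<in> S"
      using just by (auto simp: nth_default_nth)
    show ?thesis unfolding Comp
      using J'(4) S[OF J'(5)] S'[OF J'(1,2)] J'(3) by (intro eval_Comp') simp_all
  next
    case (PrimRec g h)
    then have c: "list_decode (args J) = hd_code (args J) # list_decode (tl_code (args J))"
      using just by (auto simp: list_decode_pos)
    show ?thesis
    proof (cases "hd_code (args J)")
      case 0
      with PrimRec have "judgement (prog_code g) (tl_code (args J)) (result J) \<in> S" using just by auto
      from S[OF this] show ?thesis unfolding PrimRec c 0 by (rule eval_PrimRec_0)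
    next
      case (Suc n)
      with PrimRec obtain J' where J': "J' \<in> S" "subject J' = prog_code q"
        "args J' = cons_code n (tl_code (args J))"
        "judgement (prog_code h) (cons_code n (cons_code (result J') (tl_code (args J)))) (result J) \<in> S"
        using just by auto
      have "eval (\<lambda>_. 0) q (n # list_decode (tl_code (args J))) (result J')"
        using S'[OF J'(1,2)] by (simp add: J'(3))
      moreover have "eval (\<lambda>_. 0) h (n # result J' # list_decode (tl_code (args J))) (result J)"
        using S[OF J'(4)] by simp
      ultimately show ?thesis unfolding PrimRec c Suc by (rule eval_PrimRec_Suc)
    qed
  next
    case (Mu g)
    then have "judgement (prog_code g) (cons_code (result J) (args J)) 0 \<in> S" using just by auto
    from S[OF this] have 1: "eval (\<lambda>_. 0) g (result J # list_decode (args J)) 0" by simp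
    have "\<exists>y. eval (\<lambda>_. 0) g (m # list_decode (args J)) (Suc y)" if m: "m < result J" for m
    proof -
      obtain J' where J': "J' \<in> S" "subject J' = prog_code g" "args J' = cons_code m (args J)"
        "result J' > 0" using just Mu m by auto
      from J'(4) obtain y where "result J' = Suc y" by (cases "result J'") auto
      then show ?thesis using S'[OF J'(1,2)] J'(3) by auto
    qed
    with 1 show ?thesis unfolding Mu by (auto intro: eval_Mu)
  qed
qed

lemma derivation_sound: "derivation L \<Longrightarrow> J \<in> set L \<Longrightarrow> true_judgement J"
  by (induction L arbitrary: J) (auto intro: justified_sound)

text \<open>Each judgement of \<open>L\<close> keeps its justification because the list behind it
  only grows.\<close>

lemma derivation_append: "derivation L \<Longrightarrow> derivation L' \<Longrightarrow> derivation (L @ L')"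
  by (induction L) (auto intro: justified_mono[THEN mp, rotated])

text \<open>Composition and minimisation have a varying finite number of premises, whose derivations
  must be merged into one.\<close>

lemma derivation_union:
  assumes "\<And>i. i < (n::nat) \<Longrightarrow> \<exists>L. derivation L \<and> P i \<in> set L"
  shows "\<exists>L. derivation L \<and> (\<forall>i<n. P i \<in> set L)"
  using assms
proof (induction n)
  case 0
  show ?case by (intro exI[of _ "[]"]) simp
next
  case (Suc n)
  then obtain L L' where "derivation L" "\<forall>i<n. P i \<in> set L" "derivation L'" "P n \<in> set L'"
    by (metis less_Suc_eq)
  then show ?case by (intro exI[of _ "L @ L'"]) (auto simp: derivation_append less_Suc_eq)
qed

lemma derivation_complete:
  assumes "eval (\<lambda>_. 0) q xs y"
  shows "\<exists>L. derivation L \<and> judgement (prog_code q) (list_encode xs) y \<in> set L"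
    (is "\<exists>L. _ \<and> ?J q xs y \<in> _")
proof -
  have step: "\<exists>L. derivation L \<and> J \<in> set L" if "derivation L" "justified (set L) J" for L J
    using that by (intro exI[of _ "J # L"]) simp
  have code_Cons: "list_encode (x # xs) = cons_code x (list_encode xs)" for x xs
    by (simp add: cons_code_def)
  show ?thesis using assms
  proof (induction rule: eval.induct)
    case (eval_Zero xs)
    show ?case by (rule step[of "[]"]) (simp_all add: justified_def Let_def)
  next
    case (eval_Succ x xs)
    show ?case by (rule step[of "[]"]) (simp_all add: justified_def Let_def code_Cons del: list_encode.simps)
  next
    case (eval_Oracle x xs)
    show ?case by (rule step[of "[]"]) (simp_all add: justified_def Let_def code_Cons del: list_encode.simps)
  next
    case (eval_Proj i xs)
    then show ?case by (intro step[of "[]"]) (simp_all add: justified_def Let_def nth_default_nth)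
  next
    case (eval_Comp ys gs xs h z)
    obtain L1 where L1: "derivation L1" "\<forall>i<length gs. ?J (gs ! i) xs (ys ! i) \<in> set L1"
      using derivation_union[of "length gs" "\<lambda>i. ?J (gs ! i) xs (ys ! i)"] eval_Comp.IH(1) by blast
    obtain L2 where L2: "derivation L2" "?J h ys z \<in> set L2" using eval_Comp.IH(2) by blast
    show ?case
    proof (rule step)
      show "derivation (L1 @ L2)" using L1(1) L2(1) by (rule derivation_append)
      show "justified (set (L1 @ L2)) (?J (Comp h gs) xs z)"
        using L1(2) L2(2) eval_Comp.hyps(1) unfolding justified_def Let_def
        by (auto simp: nth_default_nth intro!: bexI[of _ "?J h ys z"])
    qed
  next
    case (eval_PrimRec_0 g xs y h)
    then obtain L where L: "derivation L" "?J g xs y \<in> set L" by blast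
    then show ?case
      by (intro step[of L]) (simp_all add: justified_def Let_def code_Cons del: list_encode.simps)
  next
    case (eval_PrimRec_Suc g h n xs y z)
    then obtain L L' where L: "derivation L" "?J (PrimRec g h) (n # xs) y \<in> set L"
      "derivation L'" "?J h (n # y # xs) z \<in> set L'" by blast
    show ?case
    proof (rule step)
      show "derivation (L @ L')" using L(1,3) by (rule derivation_append)
      show "justified (set (L @ L')) (?J (PrimRec g h) (Suc n # xs) z)"
        using L(2,4) unfolding justified_def Let_def
        by (auto simp: code_Cons simp del: list_encode.simps
            intro!: bexI[of _ "?J (PrimRec g h) (n # xs) y"])
    qed
  next
    case (eval_Mu g n xs)
    obtain L where L: "derivation L" "?J g (n # xs) 0 \<in> set L" using eval_Mu.IH(1) by blast
    obtain Y where Y: "\<And>m. m < n \<Longrightarrow> \<exists>L. derivation L \<and> ?J g (m # xs) (Suc (Y m)) \<in> set L"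
      using eval_Mu.IH(2) by metis
    obtain L' where L': "derivation L'" "\<forall>m<n. ?J g (m # xs) (Suc (Y m)) \<in> set L'"
      using derivation_union[of n "\<lambda>m. ?J g (m # xs) (Suc (Y m))"] Y by blast
    show ?case
    proof (rule step)
      show "derivation (L @ L')" using L(1) L'(1) by (rule derivation_append)
      have "\<exists>J'\<in>set (L @ L'). subject J' = prog_code g \<and>
          args J' = cons_code m (list_encode xs) \<and> 0 < result J'" if "m < n" for m
        using L'(2) that
        by (intro bexI[of _ "?J g (m # xs) (Suc (Y m))"]) (auto simp: code_Cons simp del: list_encode.simps)
      then show "justified (set (L @ L')) (?J (Mu g) xs n)"
        using L(2) unfolding justified_def Let_def by (simp add: code_Cons del: list_encode.simps)
    qed
  qed
qed

lemma decidable_mem_list [computable_intros]: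
  assumes "computable f A" "computable f B"
  shows "decidable f (\<lambda>v. B v \<in> set (list_decode (A v)))"
proof -
  have "decidable f (\<lambda>v. \<exists>x\<in>set (list_decode (v 0)). x = v (Suc 0))" by (intro computable_intros)
  then have "decidable f (\<lambda>v. v (Suc 0) \<in> set (list_decode (v 0)))" by simp
  then show ?thesis by (rule decidable_subst2) fact+
qed

lemma decidable_justified [computable_intros]:
  assumes "computable f A" "computable f B"
  shows "decidable f (\<lambda>v. justified (set (list_decode (A v))) (B v))"
proof -
  \<comment> \<open>With plain variables as arguments the closure rules need no shifted forms of the
    assumptions under the binders; the general case follows by substitution.\<close>
  have "decidable f (\<lambda>v. justified (set (list_decode (v 0))) (v (Suc 0)))"
    unfolding justified_def Let_def judgement_def subject_def args_def result_def
      cons_code_def hd_code_def tl_code_def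
    by (intro computable_intros)
  then show ?thesis by (rule decidable_subst2) fact+
qed

text \<open>Turns the recursion over the list into a bounded quantifier over positions, to which the
  closure properties apply.\<close>

lemma derivation_conv_drop:
  "derivation L \<longleftrightarrow> (\<forall>j<length L. justified (set (drop (Suc j) L)) (nth_default 0 L j))"
  by (induction L) (auto simp: nth_default_Cons All_less_Suc2)

lemma decidable_derivation [computable_intros]:
  assumes "computable f A" shows "decidable f (\<lambda>v. derivation (list_decode (A v)))"
proof -
  have "derivation (list_decode d) \<longleftrightarrow> (\<forall>j<length (list_decode d).
      justified (set (list_decode (list_encode (drop (Suc j) (list_decode d))))) (entry d j))" for d
    by (simp add: derivation_conv_drop)
  moreover have "decidable f (\<lambda>v. \<forall>j<length (list_decode (v 0)).
      justified (set (list_decode (list_encode (drop (Suc j) (list_decode (v 0)))))) (entry (v 0) j))"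
    by (intro computable_intros)
  ultimately have "decidable f (\<lambda>v. derivation (list_decode (v 0)))" by presburger
  then show ?thesis by (rule decidable_subst1) fact
qed

section \<open>A recursive injection with non-recursive range\<close>

text \<open>\<open>s\<close> codes a pair of a program and a derivation that it outputs \<open>0\<close> on its own code.\<close>

definition diagonal_proof :: "nat \<Rightarrow> bool" where
  "diagonal_proof s \<longleftrightarrow> derivation (list_decode (snd (prod_decode s))) \<and>
     judgement (fst (prod_decode s)) (cons_code (fst (prod_decode s)) 0) 0
       \<in> set (list_decode (snd (prod_decode s)))"

text \<open>The first proofs for the various programs are sent to even numbers, all other stages to odd
  numbers, which makes the enumeration injective.\<close>

definition diagonal_enum :: "nat \<Rightarrow> nat" where
  "diagonal_enum s =
     (if diagonal_proof s \<and>
         (\<forall>t<s. \<not> (diagonal_proof t \<and> fst (prod_decode t) = fst (prod_decode s)))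
      then 2 * fst (prod_decode s) else Suc (2 * s))"

lemma inj_diagonal_enum: "inj diagonal_enum"
proof (rule linorder_injI)
  fix s t :: nat assume "s < t"
  have parity: "2 * a \<noteq> Suc (2 * b)" "Suc (2 * b) \<noteq> 2 * a" for a b :: nat by presburger+
  show "diagonal_enum s \<noteq> diagonal_enum t"
    unfolding diagonal_enum_def using \<open>s < t\<close> by (auto simp: parity)
qed

lemma even_in_range_diagonal_enum:
  "2 * e \<in> range diagonal_enum \<longleftrightarrow> (\<exists>s. diagonal_proof s \<and> fst (prod_decode s) = e)"
proof
  assume "2 * e \<in> range diagonal_enum"
  then obtain s where "diagonal_enum s = 2 * e" by (metis imageE)
  moreover have "Suc (2 * s) \<noteq> 2 * e" by presburger
  ultimately show "\<exists>s. diagonal_proof s \<and> fst (prod_decode s) = e"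
    by (auto simp: diagonal_enum_def split: if_splits)
next
  assume ex: "\<exists>s. diagonal_proof s \<and> fst (prod_decode s) = e"
  define s where "s = (LEAST s. diagonal_proof s \<and> fst (prod_decode s) = e)"
  have "diagonal_proof s \<and> fst (prod_decode s) = e" unfolding s_def using ex by (rule LeastI_ex)
  moreover have "\<not> (diagonal_proof t \<and> fst (prod_decode t) = e)" if "t < s" for t
    using that unfolding s_def by (rule not_less_Least)
  ultimately have "diagonal_enum s = 2 * e" by (simp add: diagonal_enum_def)
  then show "2 * e \<in> range diagonal_enum" by (metis rangeI)
qed

lemma recursive_diagonal_enum: "recursive diagonal_enum"
  unfolding recursive_def
proof (rule recursive_inI)
  have dec: "decidable f (\<lambda>v. diagonal_proof (A v))" if "computable f A" for f A
    unfolding diagonal_proof_def judgement_def cons_code_def by (intro computable_intros that)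
  show "computable (\<lambda>_. 0) (\<lambda>v. diagonal_enum (v 0))"
    unfolding diagonal_enum_def by (intro dec computable_intros)
qed

text \<open>Diagonalisation: by soundness and completeness of derivations, \<open>2 * e\<close> is
  in the range for the code \<open>e\<close> of a program \<open>q\<close> exactly if
  \<open>q\<close> outputs 0 on \<open>e\<close>. A program deciding membership of
  \<open>2 * n\<close> would have to output 0 on its own code exactly if it does not.\<close>

lemma not_recursive_range_diagonal_enum:
  "\<not> recursive (\<lambda>n. of_bool (n \<in> range diagonal_enum))"
proof
  assume rec: "recursive (\<lambda>n. of_bool (n \<in> range diagonal_enum))"
  have "recursive_in (\<lambda>_. 0) (\<lambda>n. of_bool (2 * n \<in> range diagonal_enum))"
    by (rule recursive_inI) (intro computable_recursive[OF rec] computable_intros)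
  then obtain q where q: "\<And>n. eval (\<lambda>_. 0) q [n] (of_bool (2 * n \<in> range diagonal_enum))"
    unfolding recursive_in_def by blast
  define e where "e = prog_code q"
  \<comment> \<open>0 codes the empty list, so \<open>cons_code e 0\<close> is the one-element
    argument list used in \<open>diagonal_proof\<close>.\<close>
  have code: "list_encode [e] = cons_code e 0" by (simp add: cons_code_def)
  show False
  proof (cases "2 * e \<in> range diagonal_enum")
    case True
    then obtain s where "diagonal_proof s" "fst (prod_decode s) = e"
      unfolding even_in_range_diagonal_enum by blast
    then have "true_judgement (judgement e (cons_code e 0) 0)"
      unfolding diagonal_proof_def by (metis derivation_sound)
    then have "eval (\<lambda>_. 0) q [e] 0" by (simp add: true_judgement_def e_def)
    from eval_deterministic[OF this q] True show False by simp
  next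
    case False
    then have "eval (\<lambda>_. 0) q [e] 0" using q[of e] by simp
    from derivation_complete[OF this] obtain L
      where "derivation L" "judgement e (cons_code e 0) 0 \<in> set L"
      unfolding code e_def[symmetric] by blast
    then have "diagonal_proof (prod_encode (e, list_encode L))" by (simp add: diagonal_proof_def)
    with False show False unfolding even_in_range_diagonal_enum by force
  qed
qed

section \<open>True stages\<close>

text \<open>\<open>looks_true h s t\<close> is the guess at stage \<open>s\<close> whether \<open>t\<close> is a true stage.  It is correct if \<open>s\<close>
  itself is true, and \<open>plausible h m y\<close> requires every \<open>s < m\<close> in \<open>y\<close> to be consistent with it.\<close>

definition looks_true :: "(nat \<Rightarrow> nat) \<Rightarrow> nat \<Rightarrow> nat \<Rightarrow> bool" where
  "looks_true h s t \<longleftrightarrow> t \<le> s \<and> (\<forall>u<Suc s. t < u \<longrightarrow> h t < h u)"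

definition true_stage :: "(nat \<Rightarrow> nat) \<Rightarrow> nat \<Rightarrow> bool" where
  "true_stage h t \<longleftrightarrow> (\<forall>u>t. h t < h u)"

definition plausible :: "(nat \<Rightarrow> nat) \<Rightarrow> nat \<Rightarrow> (nat \<Rightarrow> bool) \<Rightarrow> bool" where
  "plausible h m y \<longleftrightarrow> (\<forall>s<m. y s \<longrightarrow> (\<forall>t<Suc s. y t \<longleftrightarrow> looks_true h s t))"

text \<open>All values after a true stage \<open>s\<close> exceed \<open>h s\<close>, and a
  \<open>t\<close> that looks true at \<open>s\<close> satisfies \<open>h t \<le> h s\<close>; hence
  nothing after \<open>s\<close> can refute it.\<close>

lemma true_stage_iff_looks_true:
  assumes s: "true_stage h s" and "t \<le> s"
  shows "true_stage h t \<longleftrightarrow> looks_true h s t"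
proof
  assume t: "looks_true h s t"
  have "h t < h u" if "t < u" for u
  proof (cases "u \<le> s")
    case True
    with t that show ?thesis by (simp add: looks_true_def)
  next
    case False
    have "h t \<le> h s" using t \<open>t \<le> s\<close> by (cases "t = s") (auto simp: looks_true_def)
    also have "h s < h u" using s False by (simp add: true_stage_def)
    finally show ?thesis .
  qed
  then show "true_stage h t" by (simp add: true_stage_def)
qed (use assms in \<open>auto simp: true_stage_def looks_true_def\<close>)

lemma plausible_true_stage: "plausible h m (true_stage h)"
  by (auto simp: plausible_def less_Suc_eq_le true_stage_iff_looks_true)

lemma plausible_antimono: "plausible h n y \<Longrightarrow> m \<le> n \<Longrightarrow> plausible h m y"
  by (auto simp: plausible_def)

text \<open>The condition reads only the first \<open>m\<close> bits, hence defines a clopen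
  set.\<close>

lemma plausible_cong: "(\<And>i. i < m \<Longrightarrow> y i \<longleftrightarrow> z i) \<Longrightarrow> plausible h m y \<longleftrightarrow> plausible h m z"
  unfolding plausible_def by (auto simp: less_Suc_eq_le)

lemma countable_plausible: "countable {y. \<forall>m. plausible h m y}"
proof -
  have "y = true_stage h \<or> y = (\<lambda>_. False) \<or> y \<in> range (looks_true h)"
    if pl: "\<And>m. plausible h m y" for y
  proof -
    have y: "y t \<longleftrightarrow> looks_true h s t" if "y s" "t \<le> s" for s t
      using pl[of "Suc s"] that by (auto simp: plausible_def less_Suc_eq_le)
    show ?thesis
    proof (cases "finite {t. y t}")
      case fin: True
      show ?thesis
      proof (cases "\<exists>t. y t")
        case True
        define s where "s = Max {t. y t}"
        have s: "y s" "\<And>t. y t \<Longrightarrow> t \<le> s"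
          using Max_in[of "{t. y t}"] Max_ge[of "{t. y t}"] fin True by (auto simp: s_def)
        have "y t \<longleftrightarrow> looks_true h s t" for t
          using y[OF s(1)] s(2) by (cases "t \<le> s") (auto simp: looks_true_def)
        then have "y = looks_true h s" by auto
        then show ?thesis by blast
      qed auto
    next
      case False
      then have unbounded: "\<exists>s\<ge>n. y s" for n
        using infinite_nat_iff_unbounded_le by auto
      \<comment> \<open>A value \<open>h u \<le> h t\<close> with \<open>u > t\<close> would be
        noticed at any element of \<open>y\<close> beyond \<open>u\<close>. Conversely a true stage
        looks true at every later stage, in particular at an element of \<open>y\<close>.\<close>
      have "y t \<longleftrightarrow> true_stage h t" for t
      proof
        assume "y t"
        have "h t < h u" if "u > t" for u
        proof -
          obtain s where s: "s \<ge> u" "y s" using unbounded by blast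
          with y[of s t] \<open>y t\<close> that have "looks_true h s t" by simp
          with s(1) that show ?thesis by (simp add: looks_true_def)
        qed
        then show "true_stage h t" by (simp add: true_stage_def)
      next
        assume "true_stage h t"
        obtain s where s: "s \<ge> t" "y s" using unbounded by blast
        with \<open>true_stage h t\<close> have "looks_true h s t" by (simp add: looks_true_def true_stage_def)
        with s y show "y t" by blast
      qed
      then show ?thesis by auto
    qed
  qed
  then have "{y. \<forall>m. plausible h m y} \<subseteq> {true_stage h, \<lambda>_. False} \<union> range (looks_true h)" by blast
  then show ?thesis by (rule countable_subset) simp
qed

text \<open>By injectivity only finitely many stages have values up to \<open>n\<close>. Beyond them
  a stage of least value is true, the inequalities being strict again by injectivity.\<close>

lemma ex_true_stage_gt:
  assumes "inj h" shows "\<exists>s. true_stage h s \<and> n < h s"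
proof -
  have "finite (h -` {..n})" using finite_vimageI[OF finite_atMost assms] .
  then obtain s0 where s0: "\<And>s. s \<in> h -` {..n} \<Longrightarrow> s < s0" unfolding finite_nat_set_iff_bounded by blast
  define s where "s = arg_min h (\<lambda>s. s \<ge> s0)"
  have s: "s \<ge> s0" "\<And>u. u \<ge> s0 \<Longrightarrow> h s \<le> h u"
    using arg_min_nat_lemma[of "\<lambda>s. s \<ge> s0" s0 h] by (auto simp: s_def)
  have "h s < h u" if "u > s" for u
  proof -
    have "h s \<le> h u" using s(1) that by (intro s(2)) simp
    moreover have "h s \<noteq> h u" using injD[OF assms, of s u] that by auto
    ultimately show ?thesis by simp
  qed
  moreover have "n < h s"
  proof (rule ccontr)
    assume "\<not> n < h s"
    then have "s < s0" by (intro s0) simp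
    with s(1) show False by simp
  qed
  ultimately show ?thesis by (auto simp: true_stage_def)
qed

text \<open>After a true stage \<open>s\<close> with \<open>n < h s\<close> all values exceed
  \<open>n\<close>, so it suffices to look for \<open>n\<close> among the stages up to
  \<open>s\<close>; such an \<open>s\<close> is found by search.\<close>

lemma recursive_range_if_recursive_true_stage:
  assumes "inj h" "recursive h" "recursive_real (true_stage h)"
  shows "recursive (\<lambda>n. of_bool (n \<in> range h))"
  unfolding recursive_def
proof (rule recursive_inI)
  define S where "S n = (LEAST s. true_stage h s \<and> n < h s)" for n
  have S: "true_stage h (S n)" "n < h (S n)" for n
    using LeastI_ex[OF ex_true_stage_gt[OF assms(1)], of n] unfolding S_def by blast+
  have "n \<in> range h \<longleftrightarrow> (\<exists>t<Suc (S n). h t = n)" for n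
  proof
    assume "n \<in> range h"
    then obtain t where t: "h t = n" by blast
    have "\<not> S n < t" using S[of n] t by (force simp: true_stage_def)
    with t show "\<exists>t<Suc (S n). h t = n" by (intro exI[of _ t]) simp
  qed auto
  moreover have dec: "decidable (\<lambda>_. 0) (\<lambda>v. true_stage h (A v))" if "computable (\<lambda>_. 0) A" for A
    using computable_recursive[OF assms(3)[unfolded recursive_real_def] that]
    by (simp add: decidable_def)
  have "computable (\<lambda>_. 0) (\<lambda>v. of_bool (\<exists>t<Suc (S (v 0)). h t = v 0))"
    unfolding S_def
    by (intro computable_intros computable_Least computable_recursive[OF assms(2)] dec
        ex_true_stage_gt assms(1))
  ultimately show "computable (\<lambda>_. 0) (\<lambda>v. of_bool (v 0 \<in> range h))" by presburger
qed

section \<open>Measures of unions of cylinders\<close>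

lemma cylinder_in_borel: "cylinder \<sigma> \<in> sets borel"
proof -
  have "(\<lambda>y::nat \<Rightarrow> bool. y i) -` {b} \<inter> space borel \<in> sets borel" for i b
    by (rule measurable_sets[OF borel_measurable_continuous_onI]) (auto intro: continuous_on_product_coordinates)
  then have "(\<Inter>i\<in>{..<length \<sigma>}. {y. y i = \<sigma> ! i}) \<in> sets borel" if "\<sigma> \<noteq> []"
    using that by (intro sets.finite_INT) (auto simp: vimage_def)
  moreover have "cylinder \<sigma> = (\<Inter>i\<in>{..<length \<sigma>}. {y. y i = \<sigma> ! i})"
    by (auto simp: cylinder_def)
  ultimately show ?thesis by (cases "\<sigma> = []") (auto simp: cylinder_def)
qed

lemma finite_strings: "finite {\<sigma> :: bool list. length \<sigma> = m}"
  using finite_lists_length_eq[of "UNIV :: bool set" m] by simp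

lemma disjoint_cylinders: "disjoint_family_on cylinder {\<sigma>. length \<sigma> = m}"
proof (unfold disjoint_family_on_def, intro ballI impI)
  fix \<sigma> \<tau> :: "bool list"
  assume "\<sigma> \<in> {\<sigma>. length \<sigma> = m}" "\<tau> \<in> {\<sigma>. length \<sigma> = m}" "\<sigma> \<noteq> \<tau>"
  then obtain i where "i < m" "\<sigma> ! i \<noteq> \<tau> ! i" "length \<sigma> = m" "length \<tau> = m"
    by (auto simp: list_eq_iff_nth_eq)
  then show "cylinder \<sigma> \<inter> cylinder \<tau> = {}" by (auto simp: cylinder_def)
qed

lemma measure_Union_cylinders:
  assumes "borel_prob \<mu>" "S \<subseteq> {\<sigma>. length \<sigma> = m}"
  shows "measure \<mu> (\<Union>\<sigma>\<in>S. cylinder \<sigma>) = (\<Sum>\<sigma>\<in>S. measure \<mu> (cylinder \<sigma>))"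
proof -
  interpret prob_space \<mu> using assms(1) by (simp add: borel_prob_def)
  show ?thesis
    using assms finite_subset[OF assms(2) finite_strings]
      disjoint_family_on_mono[OF assms(2) disjoint_cylinders]
    by (intro finite_measure_finite_Union) (auto simp: borel_prob_def cylinder_in_borel)
qed

lemma Union_cylinders: "(\<Union>\<sigma>\<in>{\<sigma>. length \<sigma> = m}. cylinder \<sigma>) = UNIV"
proof -
  have "y \<in> cylinder (map y [0..<m])" for y by (simp add: cylinder_def)
  then show ?thesis by force
qed

lemma sum_measure_cylinders:
  assumes "borel_prob \<mu>" shows "(\<Sum>\<sigma> | length \<sigma> = m. measure \<mu> (cylinder \<sigma>)) = 1"
proof -
  interpret prob_space \<mu> using assms by (simp add: borel_prob_def)
  have "space \<mu> = UNIV" using assms sets_eq_imp_space_eq[of \<mu> borel] by (simp add: borel_prob_def)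
  then show ?thesis
    using measure_Union_cylinders[OF assms order_refl, of m] prob_space by (simp add: Union_cylinders)
qed

text \<open>Used to bound the series in \<open>measure_dist\<close> by a geometric one, so that it
  converges.\<close>

lemma level_dist_le_2:
  assumes "borel_prob \<mu>" "borel_prob \<nu>"
  shows "(\<Sum>\<sigma> | length \<sigma> = m. \<bar>measure \<mu> (cylinder \<sigma>) - measure \<nu> (cylinder \<sigma>)\<bar>) \<le> 2"
proof -
  have "(\<Sum>\<sigma> | length \<sigma> = m. \<bar>measure \<mu> (cylinder \<sigma>) - measure \<nu> (cylinder \<sigma>)\<bar>) \<le>
      (\<Sum>\<sigma> | length \<sigma> = m. measure \<mu> (cylinder \<sigma>) + measure \<nu> (cylinder \<sigma>))"
    by (intro sum_mono) (smt (verit) measure_nonneg)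
  then show ?thesis by (simp add: sum.distrib sum_measure_cylinders assms)
qed

text \<open>A convergent series of nonnegative terms dominates each term; the factor
  \<open>2 ^ Suc m\<close> undoes the weight of level \<open>m\<close> and the factor 1/2.\<close>

lemma level_dist_le_measure_dist:
  assumes "borel_prob \<mu>" "borel_prob \<nu>" "m > 0"
  shows "(\<Sum>\<sigma> | length \<sigma> = m. \<bar>measure \<mu> (cylinder \<sigma>) - measure \<nu> (cylinder \<sigma>)\<bar>)
    \<le> 2 ^ Suc m * measure_dist \<mu> \<nu>"
proof -
  let ?d = "\<lambda>m. \<Sum>\<sigma> | length \<sigma> = m. \<bar>measure \<mu> (cylinder \<sigma>) - measure \<nu> (cylinder \<sigma>)\<bar>"
  let ?t = "\<lambda>n. (1/2) ^ Suc n * (1/2 * ?d (Suc n))"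
  have nonneg: "0 \<le> ?t n" for n by (intro mult_nonneg_nonneg sum_nonneg) auto
  have bound: "?t n \<le> (1/2) ^ n" for n
  proof -
    have "?t n \<le> (1/2) ^ Suc n * (1/2 * 2)"
      using level_dist_le_2[OF assms(1,2), of "Suc n"] by (intro mult_left_mono) auto
    also have "\<dots> \<le> (1/2) ^ n" by simp
    finally show ?thesis .
  qed
  have "summable ?t"
  proof (rule summable_comparison_test')
    show "summable (\<lambda>n. (1/2) ^ n :: real)" by (rule summable_geometric) simp
    show "norm (?t n) \<le> (1/2) ^ n" for n
      using nonneg[of n] bound[of n] by (simp only: real_norm_def abs_of_nonneg)
  qed
  \<comment> \<open>The series starts with strings of length 1, so level \<open>m > 0\<close> is the
    summand \<open>m - 1\<close>.\<close>
  then have "sum ?t {m - 1} \<le> measure_dist \<mu> \<nu>"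
    unfolding measure_dist_def by (intro sum_le_suminf nonneg) auto
  then have "(1/2) ^ Suc m * ?d m \<le> measure_dist \<mu> \<nu>" using \<open>m > 0\<close> by simp
  then have "2 ^ Suc m * ((1/2) ^ Suc m * ?d m) \<le> 2 ^ Suc m * measure_dist \<mu> \<nu>"
    by (intro mult_left_mono) auto
  then show ?thesis by (simp add: power_one_over field_simps)
qed

lemma measure_diff_le_measure_dist:
  assumes "borel_prob \<mu>" "borel_prob \<nu>" "m > 0" "S \<subseteq> {\<sigma>. length \<sigma> = m}"
  shows "\<bar>measure \<mu> (\<Union>\<sigma>\<in>S. cylinder \<sigma>) - measure \<nu> (\<Union>\<sigma>\<in>S. cylinder \<sigma>)\<bar>
    \<le> 2 ^ Suc m * measure_dist \<mu> \<nu>"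
proof -
  have "\<bar>\<Sum>\<sigma>\<in>S. measure \<mu> (cylinder \<sigma>) - measure \<nu> (cylinder \<sigma>)\<bar>
      \<le> (\<Sum>\<sigma>\<in>S. \<bar>measure \<mu> (cylinder \<sigma>) - measure \<nu> (cylinder \<sigma>)\<bar>)"
    by (rule sum_abs)
  also have "\<dots> \<le> (\<Sum>\<sigma> | length \<sigma> = m. \<bar>measure \<mu> (cylinder \<sigma>) - measure \<nu> (cylinder \<sigma>)\<bar>)"
    by (rule sum_mono2[OF finite_strings assms(4)]) simp
  also have "\<dots> \<le> 2 ^ Suc m * measure_dist \<mu> \<nu>"
    by (rule level_dist_le_measure_dist[OF assms(1-3)])
  finally show ?thesis
    by (simp add: measure_Union_cylinders[OF assms(1,4)] measure_Union_cylinders[OF assms(2,4)]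
        sum_subtractf)
qed

text \<open>Denominator and, in \<open>weight_of\<close>, numerator of the value of
  \<open>dense_measure i\<close> on a Borel set; comparing such values with rationals thus becomes
  arithmetic of natural numbers.\<close>

definition total_weight :: "nat \<Rightarrow> nat" where
  "total_weight i = (\<Sum>(\<tau>, w)\<leftarrow>decode_entries i. w)"

definition weight_of :: "nat \<Rightarrow> (nat \<Rightarrow> bool) set \<Rightarrow> nat" where
  "weight_of i A = (\<Sum>(\<tau>, w)\<leftarrow>decode_entries i. if pad_zeros \<tau> \<in> A then w else 0)"

lemma total_weight_pos: "total_weight i > 0"
  by (auto simp: total_weight_def decode_entries_def decode_entry_def split: prod.split)

text \<open>The left side groups the entries by string, since a string may be listed several times.
  In the application \<open>\<phi>\<close> is membership of the padded string in a set.\<close>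

lemma sum_weights:
  fixes \<phi> :: "bool list \<Rightarrow> nat"
  assumes "finite S" "fst ` set es \<subseteq> S"
  shows "(\<Sum>\<sigma>\<in>S. (\<Sum>(\<tau>, w)\<leftarrow>es. if \<tau> = \<sigma> then w else 0) * \<phi> \<sigma>) = (\<Sum>(\<tau>, w)\<leftarrow>es. w * \<phi> \<tau>)"
  using assms(2)
proof (induction es)
  case (Cons e es)
  obtain a b where e: "e = (a, b)" by (cases e)
  have "(if a = \<sigma> then b else 0) * \<phi> \<sigma> = (if a = \<sigma> then b * \<phi> a else 0)" for \<sigma> by simp
  with Cons assms(1) show ?case by (simp add: e sum.distrib distrib_right)
qed simp

lemma emeasure_dense_measure:
  assumes "A \<in> sets borel"
  shows "emeasure (dense_measure i) A = ennreal (real (weight_of i A) / real (total_weight i))"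
proof -
  let ?es = "decode_entries i"
  let ?N = "\<lambda>\<sigma>. \<Sum>(\<tau>, w)\<leftarrow>?es. if \<tau> = \<sigma> then w else 0"
  have weight: "real_of_rat (list_weight ?es \<sigma>) = real (?N \<sigma>) / real (total_weight i)" for \<sigma>
    unfolding list_weight_def total_weight_def of_rat_divide of_rat_of_nat_eq ..
  have "emeasure (dense_measure i) A =
      (\<Sum>\<sigma>\<in>fst ` set ?es. ennreal (of_rat (list_weight ?es \<sigma>)) * emeasure (return borel (pad_zeros \<sigma>)) A)"
    using assms by (simp add: dense_measure_def Let_def emeasure_atomic_measure)
  also have "\<dots> = (\<Sum>\<sigma>\<in>fst ` set ?es.
      ennreal (real (?N \<sigma> * of_bool (pad_zeros \<sigma> \<in> A)) / real (total_weight i)))"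
    by (intro sum.cong refl) (use assms in \<open>simp add: weight indicator_def\<close>)
  also have "\<dots> = ennreal (\<Sum>\<sigma>\<in>fst ` set ?es.
      real (?N \<sigma> * of_bool (pad_zeros \<sigma> \<in> A)) / real (total_weight i))"
    by (rule sum_ennreal) simp
  also have "\<dots> = ennreal (real (\<Sum>\<sigma>\<in>fst ` set ?es. ?N \<sigma> * of_bool (pad_zeros \<sigma> \<in> A)) / real (total_weight i))"
    by (simp only: of_nat_sum sum_divide_distrib)
  also have "(\<Sum>\<sigma>\<in>fst ` set ?es. ?N \<sigma> * of_bool (pad_zeros \<sigma> \<in> A)) = weight_of i A"
    unfolding weight_of_def by (subst sum_weights) (auto intro!: arg_cong[where f = sum_list])
  finally show ?thesis .
qed

lemma borel_prob_dense_measure: "borel_prob (dense_measure i)"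
proof -
  have sets: "sets (dense_measure i) = sets borel" and space: "space (dense_measure i) = UNIV"
    using sets.space_closed[of "borel :: (nat \<Rightarrow> bool) measure"]
      sets.sigma_sets_eq[of "borel :: (nat \<Rightarrow> bool) measure"]
    by (auto simp: dense_measure_def Let_def atomic_measure_def sets_measure_of space_measure_of)
  have "weight_of i UNIV = total_weight i" by (simp add: weight_of_def total_weight_def)
  with total_weight_pos[of i] have "emeasure (dense_measure i) UNIV = 1"
    by (simp add: emeasure_dense_measure)
  then show ?thesis unfolding borel_prob_def by (auto simp: sets space intro!: prob_spaceI)
qed

lemma measure_dense_measure:
  "A \<in> sets borel \<Longrightarrow> measure (dense_measure i) A = real (weight_of i A) / real (total_weight i)"
  by (simp add: measure_def emeasure_dense_measure)

text \<open>Since only the first \<open>m\<close> bits are read, the extension by zeros stands for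
  every member of the cylinder.\<close>

definition plausible_strings :: "(nat \<Rightarrow> nat) \<Rightarrow> nat \<Rightarrow> bool list set" where
  "plausible_strings h m = {\<sigma>. length \<sigma> = m \<and> plausible h m (pad_zeros \<sigma>)}"

lemma Union_plausible_strings:
  "(\<Union>\<sigma>\<in>plausible_strings h m. cylinder \<sigma>) = {y. plausible h m y}"
proof -
  have pl: "plausible h m y \<longleftrightarrow> plausible h m (pad_zeros \<sigma>)" if "y \<in> cylinder \<sigma>" "length \<sigma> = m" for y \<sigma>
    using that by (intro plausible_cong) (auto simp: cylinder_def pad_zeros_def)
  show ?thesis
  proof (intro set_eqI iffI)
    fix y assume "y \<in> {y. plausible h m y}"
    moreover have y: "y \<in> cylinder (map y [0..<m])" by (simp add: cylinder_def)
    ultimately have "map y [0..<m] \<in> plausible_strings h m"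
      using pl[OF y] by (simp add: plausible_strings_def)
    with y show "y \<in> (\<Union>\<sigma>\<in>plausible_strings h m. cylinder \<sigma>)" by blast
  next
    fix y assume "y \<in> (\<Union>\<sigma>\<in>plausible_strings h m. cylinder \<sigma>)"
    then obtain \<sigma> where "y \<in> cylinder \<sigma>" "length \<sigma> = m" "plausible h m (pad_zeros \<sigma>)"
      by (auto simp: plausible_strings_def)
    then show "y \<in> {y. plausible h m y}" by (simp add: pl)
  qed
qed

lemma plausible_in_borel: "{y. plausible h m y} \<in> sets borel"
proof -
  have "finite (plausible_strings h m)"
    by (rule finite_subset[OF _ finite_strings[of m]]) (auto simp: plausible_strings_def)
  then show ?thesis
    unfolding Union_plausible_strings[symmetric] by (intro sets.finite_UN cylinder_in_borel)
qed

text \<open>Continuity from above: the sets decrease to a countable intersection, and a measure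
  without atoms vanishes on countable sets.\<close>

lemma measure_plausible_tendsto_0:
  assumes "continuous_measure \<mu>" shows "(\<lambda>m. measure \<mu> {y. plausible h m y}) \<longlonglongrightarrow> 0"
proof -
  have "borel_prob \<mu>" using assms by (simp add: continuous_measure_def)
  then interpret prob_space \<mu> by (simp add: borel_prob_def)
  have sets: "sets \<mu> = sets borel" using \<open>borel_prob \<mu>\<close> by (simp add: borel_prob_def)
  have "(\<lambda>m. measure \<mu> {y. plausible h m y}) \<longlonglongrightarrow> measure \<mu> (\<Inter>m. {y. plausible h m y})"
    by (rule finite_Lim_measure_decseq)
      (auto simp: sets plausible_in_borel decseq_def intro: plausible_antimono)
  also have "(\<Inter>m. {y. plausible h m y}) = (\<Union>y\<in>{y. \<forall>m. plausible h m y}. {y})" by auto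
  also have "measure \<mu> \<dots> = 0"
  proof (rule measure_eq_0_null_sets, rule null_sets_UN'[OF countable_plausible])
    fix y
    have "(\<Inter>n. cylinder (map y [0..<n])) \<in> sets \<mu>"
      unfolding sets by (intro sets.countable_INT'') (auto simp: cylinder_in_borel)
    also have "(\<Inter>n. cylinder (map y [0..<n])) = {y}" by (auto simp: cylinder_def)
    finally have "{y} \<in> sets \<mu>" .
    then show "{y} \<in> null_sets \<mu>"
      using assms by (simp add: null_sets_def emeasure_eq_measure continuous_measure_def)
  qed
  finally show ?thesis .
qed

text \<open>The Cauchy bound controls the difference between the values of terms \<open>j\<close>
  and \<open>i\<close> on a clopen set; letting \<open>i\<close> tend to infinity replaces term
  \<open>i\<close> by \<open>\<mu>\<close>.\<close>

lemma measure_dense_measure_close: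
  assumes \<mu>: "borel_prob \<mu>" "represents p \<mu>" and "m > 0" "S \<subseteq> {\<sigma>. length \<sigma> = m}"
    and cauchy: "\<forall>i\<ge>j. measure_dist (dense_measure (p j)) (dense_measure (p i)) \<le> (1/2) ^ k"
  shows "\<bar>measure (dense_measure (p j)) (\<Union>\<sigma>\<in>S. cylinder \<sigma>) - measure \<mu> (\<Union>\<sigma>\<in>S. cylinder \<sigma>)\<bar>
    \<le> 2 ^ Suc m * (1/2) ^ k"
proof -
  let ?B = "\<Union>\<sigma>\<in>S. cylinder \<sigma>"
  let ?a = "\<lambda>i. measure (dense_measure (p i)) ?B"
  have "(\<lambda>i. ?a i - measure \<mu> ?B) \<longlonglongrightarrow> 0"
  proof (rule Lim_null_comparison)
    show "\<forall>\<^sub>F i in sequentially. norm (?a i - measure \<mu> ?B)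
        \<le> 2 ^ Suc m * measure_dist (dense_measure (p i)) \<mu>"
      unfolding real_norm_def
      by (intro always_eventually allI measure_diff_le_measure_dist borel_prob_dense_measure \<mu>(1) assms(3,4))
    show "(\<lambda>i. 2 ^ Suc m * measure_dist (dense_measure (p i)) \<mu>) \<longlonglongrightarrow> 0"
      using tendsto_mult_right_zero[OF \<mu>(2)[unfolded represents_def]] .
  qed
  then have "?a \<longlonglongrightarrow> measure \<mu> ?B" by (simp add: LIM_zero_iff)
  then have "(\<lambda>i. \<bar>?a j - ?a i\<bar>) \<longlonglongrightarrow> \<bar>?a j - measure \<mu> ?B\<bar>" by (intro tendsto_intros)
  moreover have "\<bar>?a j - ?a i\<bar> \<le> 2 ^ Suc m * (1/2) ^ k" if "i \<ge> j" for i
  proof -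
    have "\<bar>?a j - ?a i\<bar> \<le> 2 ^ Suc m * measure_dist (dense_measure (p j)) (dense_measure (p i))"
      using assms(3,4) by (intro measure_diff_le_measure_dist borel_prob_dense_measure)
    also have "\<dots> \<le> 2 ^ Suc m * (1/2) ^ k" by (intro mult_left_mono cauchy[rule_format] that) simp
    finally show ?thesis .
  qed
  ultimately show ?thesis by (intro LIMSEQ_le_const2[where X = "\<lambda>i. \<bar>?a j - ?a i\<bar>"]) blast+
qed

section \<open>The Martin-Loef test\<close>

lemma decidable_plausible:
  assumes "recursive h" "decidable f (\<lambda>v. Y (v 0) (\<lambda>i. v (Suc i)))" "computable f M"
  shows "decidable f (\<lambda>v. plausible h (M v) (\<lambda>t. Y t v))"
proof -
  note Y = assms(2)[unfolded decidable_def]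
  \<comment> \<open>In \<open>plausible\<close> the set is also queried at \<open>t\<close> below
    two binders, \<open>s\<close> and \<open>t\<close>; there variable 1 is \<open>s\<close> and has
    to be skipped.\<close>
  have "computable f (\<lambda>v. of_bool (Y (v 0) (\<lambda>i. v (Suc (Suc i)))) :: nat)"
    using computable_subst[OF Y, where A = "\<lambda>i v. v (case_nat 0 (\<lambda>j. Suc (Suc j)) i)", OF computable_var]
    by simp
  then have Y2: "decidable f (\<lambda>v. Y (v 0) (\<lambda>i. v (Suc (Suc i))))" by (simp add: decidable_def)
  show ?thesis
    unfolding plausible_def looks_true_def
    by (intro assms(2,3) Y2 computable_intros computable_recursive[OF assms(1)])
qed

lemma pad_zeros_decode_entry:
  "pad_zeros (fst (decode_entry c)) = (\<lambda>t. 0 < entry (fst (prod_decode c)) t)"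
  by (auto simp: pad_zeros_def decode_entry_def nth_default_def fun_eq_iff split: prod.split)

lemma snd_decode_entry: "snd (decode_entry c) = Suc (snd (prod_decode c))"
  by (simp add: decode_entry_def split: prod.split)

text \<open>Gives list sums the form of bounded sums over positions, as
  \<open>computable_sum\<close> requires.\<close>

lemma sum_decode_entries:
  "(\<Sum>e\<leftarrow>decode_entries i. F e) = F (decode_entry (fst (prod_decode i))) +
     (\<Sum>j<length (list_decode (snd (prod_decode i))). F (decode_entry (entry (snd (prod_decode i)) j)))"
  for F :: "bool list \<times> nat \<Rightarrow> nat"
proof -
  have "(\<Sum>c\<leftarrow>xs. G c) = (\<Sum>j<length xs. G (nth_default 0 xs j))" for xs :: "nat list" and G :: "nat \<Rightarrow> nat"
    by (simp add: sum_list_sum_nth atLeast0LessThan nth_default_nth)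
  from this[of "\<lambda>c. F (decode_entry c)"] show ?thesis
    by (simp add: decode_entries_def o_def split: prod.split)
qed

lemma computable_total_weight:
  assumes "computable f A" shows "computable f (\<lambda>v. total_weight (A v))"
proof -
  have "computable f (\<lambda>v. total_weight (v 0))"
    unfolding total_weight_def case_prod_unfold sum_decode_entries snd_decode_entry
    by (intro computable_intros)
  then show ?thesis by (rule computable_subst1[where h = "\<lambda>i _. total_weight i"]) fact
qed

lemma computable_weight_of_plausible:
  assumes "recursive h" "computable f A" "computable f M"
  shows "computable f (\<lambda>v. weight_of (A v) {y. plausible h (M v) y})"
proof -
  have "computable f (\<lambda>v. weight_of (v 0) {y. plausible h (v (Suc 0)) y})"
    unfolding weight_of_def case_prod_unfold sum_decode_entries snd_decode_entry mem_Collect_eq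
      pad_zeros_decode_entry
    by (intro decidable_plausible[OF assms(1)] computable_intros)
  then show ?thesis
    by (rule computable_subst2[where h = "\<lambda>i m. weight_of i {y. plausible h m y}"]) fact+
qed

text \<open>Trades the quantifier over strings for a condition on the number itself: codes of
  strings are the codes of lists of bits.\<close>

lemma string_code_in_iff:
  "(\<exists>\<sigma>\<in>S. c = string_code \<sigma>) \<longleftrightarrow>
     (\<forall>i<length (list_decode c). entry c i \<le> 1) \<and> map (\<lambda>k. 0 < k) (list_decode c) \<in> S"
proof -
  have code: "map (\<lambda>k. 0 < k) (list_decode (string_code \<sigma>)) = \<sigma>" for \<sigma>
    by (simp add: string_code_def o_def)
  have "entry (string_code \<sigma>) i \<le> 1" if "i < length (list_decode (string_code \<sigma>))" for \<sigma> i
    using that by (simp add: string_code_def nth_default_nth)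
  moreover have "c = string_code (map (\<lambda>k. 0 < k) (list_decode c))"
    if "\<forall>i<length (list_decode c). entry c i \<le> 1"
  proof -
    have "map of_bool (map (\<lambda>k. 0 < k) (list_decode c)) = list_decode c"
    proof (rule nth_equalityI)
      fix i assume "i < length (map of_bool (map (\<lambda>k. 0 < k) (list_decode c)))"
      moreover from this have "list_decode c ! i \<le> 1" using that by (auto simp: nth_default_nth)
      ultimately show "map of_bool (map (\<lambda>k. 0 < k) (list_decode c)) ! i = list_decode c ! i"
        by (cases "list_decode c ! i") auto
    qed simp
    then show ?thesis unfolding string_code_def by (metis list_decode_inverse)
  qed
  ultimately show ?thesis using code by metis
qed

text \<open>The set of pairs is even decidable in the oracle: \<open>Q\<close> checks on codes that
  the entries are bits, the length is right and the string is plausible.\<close>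

lemma uniformly_re_plausible_strings:
  assumes "recursive h" "\<And>A. computable f A \<Longrightarrow> computable f (\<lambda>v. M (A v))"
  shows "uniformly_re_in f (\<lambda>n. plausible_strings h (M n))"
  unfolding uniformly_re_in_def
proof (rule re_inI)
  define Q where "Q n c \<longleftrightarrow> (\<forall>i<length (list_decode c). entry c i \<le> 1) \<and>
    length (list_decode c) = M n \<and> plausible h (M n) (\<lambda>t. 0 < entry c t)" for n c
  have pad: "pad_zeros (map (\<lambda>k. 0 < k) (list_decode c)) = (\<lambda>t. 0 < entry c t)" for c
    by (auto simp: pad_zeros_def nth_default_def fun_eq_iff)
  have "z \<in> {prod_encode (n, string_code \<sigma>) |n \<sigma>. \<sigma> \<in> plausible_strings h (M n)} \<longleftrightarrow>
      Q (fst (prod_decode z)) (snd (prod_decode z))" for z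
  proof -
    have "z \<in> {prod_encode (n, string_code \<sigma>) |n \<sigma>. \<sigma> \<in> plausible_strings h (M n)} \<longleftrightarrow>
        (\<exists>\<sigma>\<in>plausible_strings h (M (fst (prod_decode z))). snd (prod_decode z) = string_code \<sigma>)"
      by (auto intro!: exI[of _ "fst (prod_decode z)"]) (metis prod.collapse prod_decode_inverse)
    then show ?thesis
      unfolding string_code_in_iff by (simp add: Q_def plausible_strings_def pad)
  qed
  moreover have "decidable f (\<lambda>v. Q (fst (prod_decode (v 0))) (snd (prod_decode (v 0))))"
    unfolding Q_def
    by (intro decidable_plausible[OF assms(1)] computable_intros assms(2))
  ultimately show "decidable f
      (\<lambda>v. v 0 \<in> {prod_encode (n, string_code \<sigma>) |n \<sigma>. \<sigma> \<in> plausible_strings h (M n)})"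
    by presburger
qed

text \<open>Whether \<open>\<mu>\<close> of a clopen set is small need not be decidable from
  \<open>p\<close>, but for a dense measure it is. So level \<open>n\<close> of the test searches
  for an \<open>m\<close> at which a sufficiently close dense measure is small.\<close>

lemma not_random_true_stage:
  assumes h: "recursive h" and g: "recursive g"
    and \<mu>: "continuous_measure \<mu>" "represents p \<mu>"
    and cauchy: "\<forall>k. \<forall>i \<ge> g k. \<forall>j \<ge> g k.
      measure_dist (dense_measure (p i)) (dense_measure (p j)) \<le> (1/2) ^ k"
  shows "\<not> random_wrt \<mu> p (true_stage h)"
proof -
  have bp: "borel_prob \<mu>" using \<mu>(1) by (simp add: continuous_measure_def)
  let ?B = "\<lambda>m. {y. plausible h m y}"
  \<comment> \<open>The factor \<open>2 ^ Suc m\<close> of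
    \<open>measure_dense_measure_close\<close> times the precision
    \<open>(1/2) ^ (m + n + 3)\<close> leaves an error of \<open>(1/2) ^ (n + 2)\<close>.\<close>
  define a where "a n m = p (g (m + n + 3))" for n m
  define small where
    "small n m \<longleftrightarrow> 0 < m \<and> 2 ^ Suc n * weight_of (a n m) (?B m) \<le> total_weight (a n m)" for n m
  have small_iff: "small n m \<longleftrightarrow> 0 < m \<and> measure (dense_measure (a n m)) (?B m) \<le> (1/2) ^ Suc n" for n m
  proof -
    have "measure (dense_measure (a n m)) (?B m) \<le> (1/2) ^ Suc n \<longleftrightarrow>
        real (2 ^ Suc n * weight_of (a n m) (?B m)) \<le> real (total_weight (a n m))"
      using total_weight_pos[of "a n m"]
      by (simp add: measure_dense_measure plausible_in_borel power_one_over field_simps)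
    then show ?thesis unfolding small_def of_nat_le_iff by simp
  qed
  have close: "\<bar>measure (dense_measure (a n m)) (?B m) - measure \<mu> (?B m)\<bar> \<le> (1/2) ^ (n + 2)"
    if "m > 0" for n m
  proof -
    have "\<bar>measure (dense_measure (a n m)) (?B m) - measure \<mu> (?B m)\<bar> \<le> 2 ^ Suc m * (1/2) ^ (m + n + 3)"
      unfolding a_def Union_plausible_strings[symmetric]
      by (rule measure_dense_measure_close[OF bp \<mu>(2) that])
        (use cauchy in \<open>auto simp: plausible_strings_def\<close>)
    also have "\<dots> = (1/2) ^ (n + 2)" by (simp add: power_add power_one_over field_simps)
    finally show ?thesis .
  qed
  have ex: "\<exists>m. small n m" for n
  proof -
    have "\<forall>\<^sub>F m in sequentially. measure \<mu> (?B m) < (1/2) ^ (n + 2)"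
      using measure_plausible_tendsto_0[OF \<mu>(1)] by (rule order_tendstoD) simp
    then have "\<forall>\<^sub>F m in sequentially. measure \<mu> (?B m) < (1/2) ^ (n + 2) \<and> 0 < m"
      by (intro eventually_conj eventually_gt_at_top)
    then obtain m where m: "measure \<mu> (?B m) < (1/2) ^ (n + 2)" "0 < m"
      using eventually_happens'[OF sequentially_bot] by blast
    \<comment> \<open>The threshold of \<open>small\<close> is twice the bound achieved by
      \<open>\<mu>\<close>, which leaves room for the approximation error.\<close>
    have "measure (dense_measure (a n m)) (?B m) \<le> (1/2) ^ (n + 2) + (1/2) ^ (n + 2)"
      using close[OF m(2), of n] m(1) by linarith
    then have "small n m" unfolding small_iff using m(2) by simp
    then show ?thesis ..
  qed
  define M where "M n = (LEAST m. small n m)" for n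
  have M: "small n (M n)" for n unfolding M_def using ex by (rule LeastI_ex)
  have "Martin_Loef_test \<mu> p (\<lambda>n. plausible_strings h (M n))"
    unfolding Martin_Loef_test_def
  proof (intro conjI allI)
    have "computable p (\<lambda>v. a (v (Suc 0)) (v 0))"
      unfolding a_def by (intro computable_oracle computable_recursive[OF g] computable_intros)
    then have "decidable p (\<lambda>v. small (v (Suc 0)) (v 0))"
      unfolding small_def
      by (intro computable_intros computable_total_weight computable_weight_of_plausible[OF h])
    then have "computable p (\<lambda>v. M (v 0))"
      unfolding M_def by (rule computable_Least) (rule ex)
    then have "computable p (\<lambda>v. M (A v))" if "computable p A" for A
      by (rule computable_subst1[where h = "\<lambda>n _. M n"]) fact
    then show "uniformly_re_in p (\<lambda>n. plausible_strings h (M n))"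
      by (rule uniformly_re_plausible_strings[OF h])
  next
    fix n
    have fin: "finite (plausible_strings h (M n))"
      by (rule finite_subset[OF _ finite_strings[of "M n"]]) (auto simp: plausible_strings_def)
    interpret prob_space \<mu> using bp by (simp add: borel_prob_def)
    have "(\<Sum>\<^sub>\<infinity>\<sigma>\<in>plausible_strings h (M n). emeasure \<mu> (cylinder \<sigma>)) =
        (\<Sum>\<sigma>\<in>plausible_strings h (M n). ennreal (measure \<mu> (cylinder \<sigma>)))"
      by (simp add: infsum_finite fin emeasure_eq_measure)
    also have "\<dots> = ennreal (measure \<mu> (?B (M n)))"
      unfolding Union_plausible_strings[symmetric]
      by (subst measure_Union_cylinders[OF bp, of _ "M n"]) (auto simp: plausible_strings_def)
    also have "\<dots> \<le> ennreal ((1/2) ^ n)"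
    proof (rule ennreal_leI)
      \<comment> \<open>Threshold and error together make up three quarters of
        \<open>(1/2) ^ n\<close>.\<close>
      have "measure \<mu> (?B (M n)) \<le> (1/2) ^ Suc n + (1/2) ^ (n + 2)"
        using close[of "M n" n] M[of n] unfolding small_iff by linarith
      also have "\<dots> \<le> (1/2) ^ n" by simp
      finally show "measure \<mu> (?B (M n)) \<le> (1/2) ^ n" .
    qed
    finally show "(\<Sum>\<^sub>\<infinity>\<sigma>\<in>plausible_strings h (M n). emeasure \<mu> (cylinder \<sigma>)) \<le> ennreal ((1/2) ^ n)" .
  qed
  moreover have "true_stage h \<in> (\<Inter>n. \<Union>\<sigma>\<in>plausible_strings h (M n). cylinder \<sigma>)"
    unfolding Union_plausible_strings by (simp add: plausible_true_stage)
  ultimately show ?thesis unfolding random_wrt_def by blast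
qed

theorem theorem5p1:
  fixes P :: "(nat \<Rightarrow> nat) set"
  assumes "representation_class P"
  shows "\<exists>x :: nat \<Rightarrow> bool. \<not> recursive_real x \<and>
           (\<forall>\<mu> p. continuous_measure \<mu> \<and> p \<in> P \<and> represents p \<mu> \<longrightarrow> \<not> random_wrt \<mu> p x)"
proof (intro exI conjI allI impI)
  show "\<not> recursive_real (true_stage diagonal_enum)"
    using recursive_range_if_recursive_true_stage[OF inj_diagonal_enum recursive_diagonal_enum]
      not_recursive_range_diagonal_enum by blast
  obtain g where g: "recursive g" "\<forall>p\<in>P. \<forall>k. \<forall>m \<ge> g k. \<forall>n \<ge> g k.
      measure_dist (dense_measure (p m)) (dense_measure (p n)) \<le> (1/2) ^ k"
    using assms unfolding representation_class_def by blast
  fix \<mu> p assume "continuous_measure \<mu> \<and> p \<in> P \<and> represents p \<mu>"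
  with g show "\<not> random_wrt \<mu> p (true_stage diagonal_enum)"
    by (intro not_random_true_stage[OF recursive_diagonal_enum]) auto
qed

end
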